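(* Let $N\ge 1$ be an integer and $H\in(1-\tfrac{1}{2N},1)$ a real number, and let $X^{N,H}=\{X^{N,H}(t)\}_{t\ge 0}$ be the Hermite process of rank $N$ and parameter $H$ (continuous modification). There exist an event $\Omega^*$ of probability $1$ and a strictly positive deterministic finite constant $c^*_{N,H}$ depending only on $(N,H)$ such that both of the following hold. (a) For every increasing continuous function $S$ on $\mathbb{R}_+$ satisfying $S(0)\ge 2$, $\lim_{z\to+\infty}z^{\frac{N}{2(1-H)}}/S(z)=0$, $\lim_{z\to+\infty}z^{\frac{N}{2(1-H)}+\varepsilon}/S(z)=+\infty$ for every fixed $\varepsilon>0$, and $\sup_{z\in\mathbb{R}_+}S\big(z+\alpha\log_2(2+z)\big)/S(z)<+\infty$ for each fixed $\alpha>0$, for all $\omega\in\Omega^*$ and all $\tau\in(0,+\infty)$, $$\liminf_{r\to 0^+}\Big\{\Big(r^{-1}|\log_2 r|\,S(|\log_2 r|)\Big)^{N(H-1)+1}\,\mathrm{Osc}\big(X^{N,H}(\omega),\tau,r\big)\Big\}\ge c^*_{N,H}.$$ (b) For every real number $\mu\in\big(N(H-1)+1,1\big)$, for all $\omega\in\Omega^*$ and for each $\tau\in(0,+\infty)$, $$\limsup_{t\to\tau}\frac{\big|X^{N,H}(t,\omega)-X^{N,H}(\tau,\omega)\big|}{|t-\tau|^\mu}=+\infty .$$ In particular, for every $\omega\in\Omega^*$, the path $t\mapsto X^{N,H}(t,\omega)$ is nowhere differentiable on $(0,+\infty)$.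
   Context: $B=\{B(x)\}_{x\in\mathbb{R}}$ is a real-valued Brownian motion on a probability space $(\Omega,\mathcal{F},\mathbb{P})$, fixed once and for all. For $(y,\alpha)\in\mathbb{R}^2$, $y_+^\alpha:=y^\alpha$ if $y>0$ and $y_+^\alpha:=0$ otherwise. The Hermite process of rank $N$ and parameter $H$ is defined, for $t\in\mathbb{R}_+=[0,+\infty)$, by the multiple Wiener integral $$X^{N,H}(t):=\int_{\mathbb{R}^N}'\Big(\int_0^t\prod_{p=1}^N(s-x_p)_+^{H-3/2}\,ds\Big)\,dB(x_1)\cdots dB(x_N),$$ where $\int'_{\mathbb{R}^N}$ denotes the multiple Wiener(-Itô) integral of order $N$ with respect to $B$ (integration over $\mathbb{R}^N$ with the diagonals $\{x_{p'}=x_{p''}\}$, $p'\neq p''$, excluded), normalized so that for symmetric $f\in L^2(\mathbb{R}^N)$ its second moment is $N!\,\|f\|_{L^2(\mathbb{R}^N)}^2$. The process has a modification with continuous paths, and $X^{N,H}$ always denotes this modification. For $\omega\in\Omega$, $\tau\in(0,+\infty)$ and $r\in(0,\tau]$, the local oscillation is $$\mathrm{Osc}\big(X^{N,H}(\omega),\tau,r\big):=\sup\big\{|X^{N,H}(t',\omega)-X^{N,H}(t'',\omega)|:\ (t',t'')\in[\tau-r,\tau+r]^2\big\}.$$ $\log_2$ is the logarithm to base $2$. *)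

theory Defs
  imports "HOL-Probability.Probability"
begin

text \<open>
  Two-sided Brownian motion. The increments over disjoint intervals, on either side of the
  origin, are independent and centred Gaussian with variance the length of the interval.
\<close>

locale brownian_motion = prob_space M for M :: "'w measure" +
  fixes B :: "real \<Rightarrow> 'w \<Rightarrow> real"
  assumes measurable_B: "\<And>x. B x \<in> borel_measurable M"
    and B_zero: "AE \<omega> in M. B 0 \<omega> = 0"
    and continuous_B: "AE \<omega> in M. continuous_on UNIV (\<lambda>x. B x \<omega>)"
    and normal_increments: "\<And>x y. x < y \<Longrightarrow>
      distributed M lborel (\<lambda>\<omega>. B y \<omega> - B x \<omega>) (normal_density 0 (sqrt (y - x)))"
    and indep_increments: "\<And>(n::nat) x. strict_mono_on {..n} x \<Longrightarrow>
      indep_vars (\<lambda>_. borel) (\<lambda>i \<omega>. B (x (Suc i)) \<omega> - B (x i) \<omega>) {..<n}"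

text \<open>
  Multiple Wiener integral of order \<open>N\<close>. A point of \<open>\<real>\<^sup>N\<close> is a function \<open>nat \<Rightarrow> real\<close> restricted
  to \<open>{..<N}\<close>. Given a grid \<open>x 0 < \<dots> < x n\<close>, a step function takes the value \<open>a i\<close> on the box
  with sides \<open>(x (i p), x (i p + 1)]\<close>, \<open>p < N\<close>; only multi-indices \<open>i\<close> with pairwise distinct
  entries are allowed, so step functions vanish on the diagonals.
\<close>

definition offdiag_indices :: "nat \<Rightarrow> nat \<Rightarrow> (nat \<Rightarrow> nat) set" where
  "offdiag_indices N n = {i \<in> {..<N} \<rightarrow>\<^sub>E {..<n}. inj_on i {..<N}}"

definition step_function ::
    "nat \<Rightarrow> nat \<Rightarrow> (nat \<Rightarrow> real) \<Rightarrow> ((nat \<Rightarrow> nat) \<Rightarrow> real) \<Rightarrow> (nat \<Rightarrow> real) \<Rightarrow> real" where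
  "step_function N n x a u =
     (\<Sum>i\<in>offdiag_indices N n. a i * (\<Prod>p<N. indicator {x (i p)<..x (Suc (i p))} (u p)))"

definition step_integral ::
    "(real \<Rightarrow> 'w \<Rightarrow> real) \<Rightarrow> nat \<Rightarrow> nat \<Rightarrow> (nat \<Rightarrow> real) \<Rightarrow> ((nat \<Rightarrow> nat) \<Rightarrow> real) \<Rightarrow> 'w \<Rightarrow> real" where
  "step_integral B N n x a \<omega> =
     (\<Sum>i\<in>offdiag_indices N n. a i * (\<Prod>p<N. B (x (Suc (i p))) \<omega> - B (x (i p)) \<omega>))"

text \<open>
  The integral is extended from step functions to \<open>L\<^sup>2(\<real>\<^sup>N)\<close> by \<open>L\<^sup>2\<close>-limits. It is a relation,
  since its value \<open>Y\<close> is determined only up to almost sure equality. No factor \<open>1 / N!\<close> is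
  inserted, so for symmetric \<open>f\<close> the second moment of \<open>Y\<close> is \<open>N!\<close> times the squared norm of \<open>f\<close>.
  The use of nonnegative integrals makes convergence to \<open>0\<close> imply that \<open>f\<close> and \<open>Y\<close> are
  square integrable.
\<close>

definition has_multiple_wiener_integral ::
    "'w measure \<Rightarrow> (real \<Rightarrow> 'w \<Rightarrow> real) \<Rightarrow> nat \<Rightarrow> ((nat \<Rightarrow> real) \<Rightarrow> real) \<Rightarrow> ('w \<Rightarrow> real) \<Rightarrow> bool" where
  "has_multiple_wiener_integral M B N f Y \<longleftrightarrow>
     f \<in> borel_measurable (\<Pi>\<^sub>M p\<in>{..<N}. lborel) \<and>
     Y \<in> borel_measurable M \<and>
     (\<exists>(n :: nat \<Rightarrow> nat) x a.
        (\<forall>k. strict_mono_on {..n k} (x k)) \<and>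
        (\<lambda>k. \<integral>\<^sup>+u. ennreal ((f u - step_function N (n k) (x k) (a k) u)\<^sup>2) \<partial>(\<Pi>\<^sub>M p\<in>{..<N}. lborel))
          \<longlonglongrightarrow> 0 \<and>
        (\<lambda>k. \<integral>\<^sup>+\<omega>. ennreal ((Y \<omega> - step_integral B N (n k) (x k) (a k) \<omega>)\<^sup>2) \<partial>M)
          \<longlonglongrightarrow> 0)"

definition pos_powr :: "real \<Rightarrow> real \<Rightarrow> real" where
  "pos_powr y \<alpha> = (if y > 0 then y powr \<alpha> else 0)"

text \<open>
  For \<open>H > 1 / 2\<close> the integrand below is integrable whenever the coordinates of \<open>u\<close> are pairwise
  distinct, so the default value \<open>0\<close> of the integral intervenes on a null set only.
\<close>

definition hermite_kernel :: "nat \<Rightarrow> real \<Rightarrow> real \<Rightarrow> (nat \<Rightarrow> real) \<Rightarrow> real" where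
  "hermite_kernel N H t u = (LINT s:{0..t}|lborel. (\<Prod>p<N. pos_powr (s - u p) (H - 3/2)))"

text \<open>
  \<open>X\<close> is a continuous modification of the Hermite process; only its values at times \<open>t \<ge> 0\<close> matter.
\<close>

definition hermite_process ::
    "'w measure \<Rightarrow> (real \<Rightarrow> 'w \<Rightarrow> real) \<Rightarrow> nat \<Rightarrow> real \<Rightarrow> (real \<Rightarrow> 'w \<Rightarrow> real) \<Rightarrow> bool" where
  "hermite_process M B N H X \<longleftrightarrow>
     (\<forall>t\<ge>0. has_multiple_wiener_integral M B N (hermite_kernel N H t) (X t)) \<and>
     (\<forall>\<omega>\<in>space M. continuous_on {0..} (\<lambda>t. X t \<omega>))"

text \<open>
  Local oscillation of a path \<open>f\<close>, for \<open>0 < r \<le> \<tau>\<close>; the supremum is finite when \<open>f\<close> is continuous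
  on the nonnegative half-line.
\<close>

definition Osc :: "(real \<Rightarrow> real) \<Rightarrow> real \<Rightarrow> real \<Rightarrow> real" where
  "Osc f \<tau> r = (SUP (t', t'')\<in>{\<tau> - r..\<tau> + r} \<times> {\<tau> - r..\<tau> + r}. \<bar>f t' - f t''\<bar>)"

definition admissible_rate :: "nat \<Rightarrow> real \<Rightarrow> (real \<Rightarrow> real) \<Rightarrow> bool" where
  "admissible_rate N H S \<longleftrightarrow>
     mono_on {0..} S \<and> continuous_on {0..} S \<and> S 0 \<ge> 2 \<and>
     ((\<lambda>z. z powr (real N / (2 * (1 - H))) / S z) \<longlongrightarrow> 0) at_top \<and>
     (\<forall>\<epsilon>>0. filterlim (\<lambda>z. z powr (real N / (2 * (1 - H)) + \<epsilon>) / S z) at_top at_top) \<and>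
     (\<forall>\<alpha>>0. bdd_above ((\<lambda>z. S (z + \<alpha> * log 2 (2 + z)) / S z) ` {0..}))"

end

theory Submission
  imports Defs "HOL-Real_Asymp.Real_Asymp"
begin

text \<open>
  The heart of the matter is that every increment of the Hermite process has a nondegenerate
  conditional law given the Brownian path up to its left end point. Put \<open>h = N * (H - 1) + 1\<close>.
  Given the past of \<open>t\<close>, the increment \<open>X (t + \<delta>) - X t\<close> is a polynomial of degree at most \<open>N\<close> in the
  Brownian motion on \<open>{t<..t + \<delta>}\<close>. Its part of full degree \<open>N\<close> is the multiple integral of the kernel
  over the cube with side \<open>{t<..t + \<delta>}\<close>. This part does not depend on the past and is orthogonal to the
  parts of lower degree, so the conditional second moment is at least a deterministic constant times
  \<open>\<delta> powr (2 * h)\<close> (\<open>hermite_kernel_box_integral\<close>). Gaussian polynomials of bounded degree satisfy a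
  reverse inequality between fourth and second moments (\<open>multilinear_fourth_moment\<close>), and the
  Paley--Zygmund argument shows that the increment is below a fixed multiple of \<open>\<delta> powr h\<close> with
  conditional probability at most some \<open>q < 1\<close> (\<open>multilinear_small_ball\<close>). Conditioning successively,
  \<open>L\<close> consecutive increments are all that small with probability at most \<open>q ^ L\<close>, although they are
  not independent (\<open>multilinear_small_ball_chain\<close>, \<open>hermite_small_increments\<close>).

  To stay with finitely many variables, conditional laws are handled for step integrals only. On a
  grid, these are multilinear polynomials in independent Gaussian variables, conditioning is Fubini's
  theorem, and the estimate passes to the limit. The approximations have to be adapted: since the
  kernel at time \<open>t\<close> vanishes as soon as one coordinate exceeds \<open>t\<close>, its step functions may be truncated
  there (\<open>wiener_adapted_approximation\<close>).

  Cut each dyadic interval of length \<open>2 ^ -m\<close> in \<open>{0..2 ^ m}\<close> into \<open>K * m\<close> pieces, where \<open>q ^ K \<le> 1 / 8\<close>. By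
  the Borel--Cantelli lemma, almost surely, at all large levels each of these intervals has a piece
  with an increment of at least the order of \<open>(2 ^ -m / m) powr h\<close>. Hence, simultaneously for all \<open>\<tau>\<close>, the
  oscillation on \<open>{\<tau> - r..\<tau> + r}\<close> is at least of the order of \<open>(r / \<bar>log 2 r\<bar>) powr h\<close> for small \<open>r\<close>
  (\<open>Osc_lower_bound_of_rough\<close>). Part (a) follows with \<open>S \<ge> 2\<close>. A Hoelder bound of order \<open>\<mu> > h\<close> at \<open>\<tau>\<close>
  would contradict this lower bound, which gives part (b), and the case \<open>\<mu> = 1\<close> gives nowhere
  differentiability.
\<close>

section \<open>Multilinear polynomials in independent Gaussian variables\<close>

definition gauss :: "real \<Rightarrow> real measure" where
  "gauss v = density lborel (normal_density 0 (sqrt v))"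

lemma sets_gauss [simp, measurable_cong]: "sets (gauss v) = sets borel"
  by (simp add: gauss_def)

lemma space_gauss [simp]: "space (gauss v) = UNIV"
  by (simp add: gauss_def)

lemma prob_space_gauss: "v > 0 \<Longrightarrow> prob_space (gauss v)"
  unfolding gauss_def by (rule prob_space_normal_density) simp

lemma nn_integral_gauss_affine_square:
  assumes "v > 0"
  shows "(\<integral>\<^sup>+y. ennreal ((a + y * b)\<^sup>2) \<partial>gauss v) = ennreal (a\<^sup>2 + v * b\<^sup>2)"
proof -
  let ?d = "normal_density 0 (sqrt v)"
  have m0: "has_bochner_integral lborel (\<lambda>y. ?d y) 1"
    using normal_moment_even[of "sqrt v" 0 0] assms by simp
  have m1: "has_bochner_integral lborel (\<lambda>y. ?d y * y) 0"
    using normal_moment_odd[of "sqrt v" 0 0] assms by simp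
  have m2: "has_bochner_integral lborel (\<lambda>y. ?d y * y^2) v"
    using normal_moment_even[of "sqrt v" 0 1] assms by simp
  have "has_bochner_integral lborel (\<lambda>y. a\<^sup>2 * ?d y + 2*a*b * (?d y * y) + b\<^sup>2 * (?d y * y^2))
      (a\<^sup>2 * 1 + 2*a*b * 0 + b\<^sup>2 * v)"
    by (intro has_bochner_integral_add has_bochner_integral_mult_right m0 m1 m2)
  also have "(\<lambda>y. a\<^sup>2 * ?d y + 2*a*b * (?d y * y) + b\<^sup>2 * (?d y * y^2)) = (\<lambda>y. ?d y * (a + y * b)\<^sup>2)"
    by (auto simp: fun_eq_iff algebra_simps power2_eq_square)
  finally have h: "has_bochner_integral lborel (\<lambda>y. ?d y * (a + y * b)\<^sup>2) (a\<^sup>2 + v * b\<^sup>2)"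
    by (simp add: mult.commute)
  have "(\<integral>\<^sup>+y. ennreal ((a + y * b)\<^sup>2) \<partial>gauss v) = (\<integral>\<^sup>+y. ennreal (?d y * (a + y * b)\<^sup>2) \<partial>lborel)"
    unfolding gauss_def by (subst nn_integral_density) (auto simp: ennreal_mult)
  also have "\<dots> = ennreal (a\<^sup>2 + v * b\<^sup>2)"
    using h by (intro nn_integral_eq_integral[THEN trans])
      (auto simp: has_bochner_integral_iff)
  finally show ?thesis .
qed

text \<open>
  The odd moments of the Gaussian vanish and its even moments are \<open>v\<close> and \<open>3 v\<^sup>2\<close>, so only the even
  terms of the binomial expansion survive.
\<close>

lemma nn_integral_gauss_affine_fourth:
  assumes "v > 0"
  shows "(\<integral>\<^sup>+y. ennreal ((a + y * b)^4) \<partial>gauss v)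
    = ennreal (a^4 + 6 * v * (a\<^sup>2 * b\<^sup>2) + 3 * v\<^sup>2 * b^4)"
proof -
  let ?d = "normal_density 0 (sqrt v)"
  have m0: "has_bochner_integral lborel (\<lambda>y. ?d y) 1"
    using normal_moment_even[of "sqrt v" 0 0] assms by simp
  have m1: "has_bochner_integral lborel (\<lambda>y. ?d y * y) 0"
    using normal_moment_odd[of "sqrt v" 0 0] assms by simp
  have m2: "has_bochner_integral lborel (\<lambda>y. ?d y * y^2) v"
    using normal_moment_even[of "sqrt v" 0 1] assms by simp
  have m3: "has_bochner_integral lborel (\<lambda>y. ?d y * y^3) 0"
    using normal_moment_odd[of "sqrt v" 0 1] assms by (simp add: numeral_3_eq_3)
  have m4: "has_bochner_integral lborel (\<lambda>y. ?d y * y^4) (3 * v\<^sup>2)"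
  proof -
    have "fact 4 / ((2 / v)^2 * fact 2) = 3 * v\<^sup>2"
      using assms by (simp add: fact_numeral power2_eq_square)
    then show ?thesis
      using normal_moment_even[of "sqrt v" 0 2] assms by simp
  qed
  have "has_bochner_integral lborel (\<lambda>y. a^4 * ?d y + 4*a^3*b * (?d y * y) + 6*a\<^sup>2*b\<^sup>2 * (?d y * y^2)
      + 4*a*b^3 * (?d y * y^3) + b^4 * (?d y * y^4))
      (a^4 * 1 + 4*a^3*b * 0 + 6*a\<^sup>2*b\<^sup>2 * v + 4*a*b^3 * 0 + b^4 * (3 * v\<^sup>2))"
    by (intro has_bochner_integral_add has_bochner_integral_mult_right m0 m1 m2 m3 m4)
  also have "(\<lambda>y. a^4 * ?d y + 4*a^3*b * (?d y * y) + 6*a\<^sup>2*b\<^sup>2 * (?d y * y^2)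
      + 4*a*b^3 * (?d y * y^3) + b^4 * (?d y * y^4)) = (\<lambda>y. ?d y * (a + y * b)^4)"
    by (auto simp: fun_eq_iff algebra_simps power2_eq_square power4_eq_xxxx power3_eq_cube)
  finally have h: "has_bochner_integral lborel (\<lambda>y. ?d y * (a + y * b)^4)
      (a^4 + 6 * v * (a\<^sup>2 * b\<^sup>2) + 3 * v\<^sup>2 * b^4)"
    by (simp add: algebra_simps)
  have "(\<integral>\<^sup>+y. ennreal ((a + y * b)^4) \<partial>gauss v) = (\<integral>\<^sup>+y. ennreal (?d y * (a + y * b)^4) \<partial>lborel)"
    unfolding gauss_def by (subst nn_integral_density) (auto simp: ennreal_mult)
  also have "\<dots> = ennreal (a^4 + 6 * v * (a\<^sup>2 * b\<^sup>2) + 3 * v\<^sup>2 * b^4)"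
    using h by (intro nn_integral_eq_integral[THEN trans])
      (auto simp: has_bochner_integral_iff)
  finally show ?thesis .
qed

text \<open>
  Integrands that vanish on the diagonals give step integrals in which every Brownian increment
  occurs with degree at most one. Such polynomials are sums of monomials indexed by the set \<open>A\<close> of
  variables that occur.
\<close>

definition multilinear :: "('i set \<Rightarrow> real) \<Rightarrow> 'i set \<Rightarrow> ('i \<Rightarrow> real) \<Rightarrow> real" where
  "multilinear c J y = (\<Sum>A\<in>Pow J. c A * (\<Prod>j\<in>A. y j))"

lemma sum_Pow_insert:
  fixes f :: "'i set \<Rightarrow> 'b::comm_monoid_add"
  assumes "finite J" "j \<notin> J"
  shows "(\<Sum>A\<in>Pow (insert j J). f A) = (\<Sum>A\<in>Pow J. f A) + (\<Sum>A\<in>Pow J. f (insert j A))"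
proof -
  have "inj_on (insert j) (Pow J)"
    using assms(2) by (intro inj_onI) (metis Diff_insert_absorb PowD insert_absorb subset_iff)
  moreover have "Pow J \<inter> insert j ` Pow J = {}"
    using assms(2) by auto
  ultimately show ?thesis
    unfolding Pow_insert using assms(1) by (subst sum.union_disjoint) (auto simp: sum.reindex)
qed

lemma prod_insert_subset:
  fixes f :: "'i \<Rightarrow> real"
  assumes "finite J" "j \<notin> J" "A \<subseteq> J"
  shows "prod f (insert j A) = f j * prod f A"
  using assms by (intro prod.insert) (auto dest: finite_subset)

text \<open>
  As a function of a single variable, a multilinear polynomial is affine. This is what makes
  induction on the number of variables effective.
\<close>

lemma multilinear_insert:
  assumes "finite J" "j \<notin> J"
  shows "multilinear c (insert j J) y = multilinear c J y + y j * multilinear (\<lambda>A. c (insert j A)) J y"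
  unfolding multilinear_def sum_Pow_insert[OF assms] sum_distrib_left
  using assms by (auto intro!: sum.cong simp: prod_insert_subset)

lemma multilinear_cong: "(\<And>j. j \<in> J \<Longrightarrow> y j = z j) \<Longrightarrow> multilinear c J y = multilinear c J z"
  unfolding multilinear_def by (intro sum.cong prod.cong arg_cong2[where f = "(*)"]) auto

lemma borel_measurable_multilinear [measurable]:
  assumes "\<And>j. j \<in> J \<Longrightarrow> sets (D j) = sets borel"
  shows "multilinear c J \<in> borel_measurable (PiM J D)"
  unfolding multilinear_def
proof (intro borel_measurable_sum borel_measurable_times borel_measurable_prod borel_measurable_const)
  fix A j assume "A \<in> Pow J" "j \<in> A"
  then have "(\<lambda>y. y j) \<in> measurable (PiM J D) (D j)"
    by (intro measurable_component_singleton) auto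
  then show "(\<lambda>y. y j) \<in> borel_measurable (PiM J D)"
    using assms[of j] \<open>A \<in> Pow J\<close> \<open>j \<in> A\<close> by (auto cong: measurable_cong_sets)
qed

lemma ennreal_le_of_square_le:
  fixes z :: ennreal
  assumes "z\<^sup>2 \<le> (ennreal r)\<^sup>2" "r \<ge> 0"
  shows "z \<le> ennreal r"
  using assms
proof (cases z)
  case (real w)
  then show ?thesis
    using assms by (auto simp: ennreal_power intro: power2_le_imp_le)
next
  case top
  then show ?thesis
    using assms by (simp add: power2_eq_square ennreal_mult_top top_unique flip: ennreal_mult)
qed

lemma nn_integral_product_squares_le:
  assumes [measurable]: "f \<in> borel_measurable Q" "g \<in> borel_measurable Q"
    and "(\<integral>\<^sup>+x. ennreal ((f x)^4) \<partial>Q) \<le> ennreal (a\<^sup>2)" "(\<integral>\<^sup>+x. ennreal ((g x)^4) \<partial>Q) \<le> ennreal (b\<^sup>2)"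
    and "a \<ge> 0" "b \<ge> 0"
  shows "(\<integral>\<^sup>+x. ennreal ((f x)\<^sup>2 * (g x)\<^sup>2) \<partial>Q) \<le> ennreal (a * b)"
proof -
  have sq: "(ennreal ((f x)\<^sup>2))\<^sup>2 = ennreal ((f x)^4)" for f :: "'b \<Rightarrow> real" and x
    by (simp add: ennreal_power)
  have "(\<integral>\<^sup>+x. ennreal ((f x)\<^sup>2) * ennreal ((g x)\<^sup>2) \<partial>Q)\<^sup>2
      \<le> (\<integral>\<^sup>+x. (ennreal ((f x)\<^sup>2))\<^sup>2 \<partial>Q) * (\<integral>\<^sup>+x. (ennreal ((g x)\<^sup>2))\<^sup>2 \<partial>Q)"
    by (rule Cauchy_Schwarz_nn_integral) measurable
  also have "\<dots> \<le> ennreal (a\<^sup>2) * ennreal (b\<^sup>2)"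
    unfolding sq by (intro mult_mono assms) auto
  also have "\<dots> = (ennreal (a * b))\<^sup>2"
    using assms by (simp add: ennreal_power power_mult_distrib flip: ennreal_mult)
  finally show ?thesis
    using assms(5,6) by (intro ennreal_le_of_square_le) (auto simp: ennreal_mult)
qed

locale gaussian_product =
  fixes v :: "'i \<Rightarrow> real"
  assumes v_pos: "\<And>j. v j > 0"
begin

abbreviation P :: "'i set \<Rightarrow> ('i \<Rightarrow> real) measure" where
  "P J \<equiv> \<Pi>\<^sub>M j\<in>J. gauss (v j)"

sublocale product_sigma_finite "\<lambda>j. gauss (v j)"
  by (intro product_sigma_finite.intro prob_space_imp_sigma_finite prob_space_gauss v_pos)

lemma prob_space_P: "prob_space (P J)"
  by (rule prob_space_PiM) (simp add: prob_space_gauss v_pos)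

lemma multilinear_measurable [measurable]: "multilinear c J \<in> borel_measurable (P J)"
  by (rule borel_measurable_multilinear) simp

lemma multilinear_upd:
  assumes "finite J" "j \<notin> J"
  shows "multilinear c (insert j J) (x(j := y)) = multilinear c J x + y * multilinear (\<lambda>A. c (insert j A)) J x"
proof -
  have "multilinear c' J (x(j := y)) = multilinear c' J x" for c'
    using assms(2) by (intro multilinear_cong) auto
  then show ?thesis
    using assms by (simp add: multilinear_insert)
qed

text \<open>
  Distinct monomials are orthogonal. In the induction this shows up as the vanishing of the cross
  term between the part that contains the new variable and the part that does not.
\<close>

lemma multilinear_second_moment:
  assumes "finite J"
  shows "(\<integral>\<^sup>+y. ennreal ((multilinear c J y)\<^sup>2) \<partial>P J) = ennreal (\<Sum>A\<in>Pow J. (c A)\<^sup>2 * prod v A)"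
  using assms
proof (induction J arbitrary: c)
  case empty
  show ?case
    by (subst nn_integral_empty) (auto simp: multilinear_def)
next
  case (insert j J)
  let ?d = "\<lambda>A. c (insert j A)"
  have nonneg: "0 \<le> (\<Sum>A\<in>Pow J. (c A)\<^sup>2 * prod v A)" for c
    by (intro sum_nonneg mult_nonneg_nonneg prod_nonneg) (auto simp: less_imp_le v_pos)
  have "(\<integral>\<^sup>+y. ennreal ((multilinear c (insert j J) y)\<^sup>2) \<partial>P (insert j J))
      = (\<integral>\<^sup>+x. (\<integral>\<^sup>+y. ennreal ((multilinear c J x + y * multilinear ?d J x)\<^sup>2) \<partial>gauss (v j)) \<partial>P J)"
    using insert.hyps by (subst product_nn_integral_insert) (simp_all add: multilinear_upd)
  also have "\<dots> = (\<integral>\<^sup>+x. ennreal ((multilinear c J x)\<^sup>2) + ennreal (v j) * ennreal ((multilinear ?d J x)\<^sup>2) \<partial>P J)"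
    by (intro nn_integral_cong)
       (simp add: nn_integral_gauss_affine_square v_pos less_imp_le flip: ennreal_plus ennreal_mult)
  also have "\<dots> = ennreal (\<Sum>A\<in>Pow J. (c A)\<^sup>2 * prod v A)
      + ennreal (v j) * ennreal (\<Sum>A\<in>Pow J. (?d A)\<^sup>2 * prod v A)"
    by (subst nn_integral_add) (auto simp: nn_integral_cmult insert.IH)
  also have "\<dots> = ennreal ((\<Sum>A\<in>Pow J. (c A)\<^sup>2 * prod v A) + v j * (\<Sum>A\<in>Pow J. (?d A)\<^sup>2 * prod v A))"
    using nonneg v_pos[of j] by (simp add: ennreal_mult ennreal_plus less_imp_le)
  also have "(\<Sum>A\<in>Pow J. (c A)\<^sup>2 * prod v A) + v j * (\<Sum>A\<in>Pow J. (?d A)\<^sup>2 * prod v A)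
      = (\<Sum>A\<in>Pow (insert j J). (c A)\<^sup>2 * prod v A)"
    unfolding sum_Pow_insert[OF insert.hyps] sum_distrib_left
    using insert.hyps by (auto intro!: sum.cong simp: prod_insert_subset)
  finally show ?case .
qed

text \<open>
  Hypercontractivity for the exponent 4, by the argument of Bonami. Let \<open>W c\<close> be the weighted sum
  on the right. For the new variable \<open>y\<close>, of variance \<open>v\<close>, write the polynomial as \<open>g + y h\<close>. Its
  fourth moment is the sum of those of \<open>g\<close> and of \<open>h\<close> with factors \<open>1\<close> and \<open>3 v\<^sup>2\<close>, and of a mixed
  term with factor \<open>6 v\<close> that Cauchy--Schwarz bounds by \<open>W g W h\<close>. The result is at most
  \<open>(W g + 3 v W h)\<^sup>2\<close>, and the weight \<open>3 ^ card A\<close> absorbs the factor \<open>3\<close> that each new variable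
  costs. Putting the degree into the weights saves tracking it through the induction.
\<close>

lemma multilinear_fourth_moment:
  assumes "finite J"
  shows "(\<integral>\<^sup>+y. ennreal ((multilinear c J y)^4) \<partial>P J)
    \<le> ennreal ((\<Sum>A\<in>Pow J. 3 ^ card A * (c A)\<^sup>2 * prod v A)\<^sup>2)"
  using assms
proof (induction J arbitrary: c)
  case empty
  show ?case
    by (subst nn_integral_empty) (auto simp: multilinear_def)
next
  case (insert j J)
  let ?d = "\<lambda>A. c (insert j A)"
  define W where "W c = (\<Sum>A\<in>Pow J. 3 ^ card A * (c A)\<^sup>2 * prod v A)" for c
  have W0: "W c \<ge> 0" for c unfolding W_def
    by (intro sum_nonneg mult_nonneg_nonneg prod_nonneg) (auto simp: less_imp_le v_pos)
  note vj = v_pos[of j]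
  have "(\<integral>\<^sup>+y. ennreal ((multilinear c (insert j J) y)^4) \<partial>P (insert j J))
      = (\<integral>\<^sup>+x. (\<integral>\<^sup>+y. ennreal ((multilinear c J x + y * multilinear ?d J x)^4) \<partial>gauss (v j)) \<partial>P J)"
    using insert.hyps by (subst product_nn_integral_insert) (simp_all add: multilinear_upd)
  also have "\<dots> = (\<integral>\<^sup>+x. ennreal ((multilinear c J x)^4)
      + ennreal (6 * v j) * ennreal ((multilinear c J x)\<^sup>2 * (multilinear ?d J x)\<^sup>2)
      + ennreal (3 * (v j)\<^sup>2) * ennreal ((multilinear ?d J x)^4) \<partial>P J)"
    using vj by (intro nn_integral_cong)
       (simp add: nn_integral_gauss_affine_fourth flip: ennreal_plus ennreal_mult)
  also have "\<dots> = (\<integral>\<^sup>+x. ennreal ((multilinear c J x)^4) \<partial>P J)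
      + ennreal (6 * v j) * (\<integral>\<^sup>+x. ennreal ((multilinear c J x)\<^sup>2 * (multilinear ?d J x)\<^sup>2) \<partial>P J)
      + ennreal (3 * (v j)\<^sup>2) * (\<integral>\<^sup>+x. ennreal ((multilinear ?d J x)^4) \<partial>P J)"
    by (simp add: nn_integral_add nn_integral_cmult)
  also have "\<dots> \<le> ennreal ((W c)\<^sup>2) + ennreal (6 * v j) * ennreal (W c * W ?d)
      + ennreal (3 * (v j)\<^sup>2) * ennreal ((W ?d)\<^sup>2)"
    by (intro add_mono mult_left_mono nn_integral_product_squares_le insert.IH[folded W_def] W0) auto
  also have "\<dots> = ennreal ((W c)\<^sup>2 + 6 * v j * (W c * W ?d) + 3 * (v j)\<^sup>2 * (W ?d)\<^sup>2)"
    using vj W0[of c] W0[of ?d] by (simp add: ennreal_mult ennreal_plus)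
  also have "\<dots> \<le> ennreal ((W c + 3 * v j * W ?d)\<^sup>2)"
    using vj by (intro ennreal_leI) (simp add: power2_sum power_mult_distrib)
  also have "W c + 3 * v j * W ?d = (\<Sum>A\<in>Pow (insert j J). 3 ^ card A * (c A)\<^sup>2 * prod v A)"
  proof -
    have "3 * v j * (3 ^ card A * (?d A)\<^sup>2 * prod v A)
        = 3 ^ card (insert j A) * (c (insert j A))\<^sup>2 * prod v (insert j A)" if "A \<subseteq> J" for A
    proof -
      have "finite A" "j \<notin> A" using that insert.hyps by (auto dest: finite_subset)
      then show ?thesis by simp
    qed
    then show ?thesis
      unfolding W_def sum_Pow_insert[OF insert.hyps] sum_distrib_left
      by (intro arg_cong2[where f = "(+)"] sum.cong) auto
  qed
  finally show ?case .
qed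

end

section \<open>Conditional small ball estimates\<close>

text \<open>
  With the variables in \<open>I\<close> held fixed, the polynomial is again multilinear in those in \<open>J\<close>, with
  coefficients that depend on the fixed values. By independence this describes the conditional law
  given the variables in \<open>I\<close>.
\<close>

lemma multilinear_freeze:
  assumes "finite I" "finite J" "I \<inter> J = {}"
  shows "multilinear c (I \<union> J) z = multilinear (\<lambda>B. \<Sum>A\<in>Pow I. c (A \<union> B) * prod z A) J z"
proof -
  have bij: "bij_betw (\<lambda>(A, B). A \<union> B) (Pow I \<times> Pow J) (Pow (I \<union> J))"
    by (rule bij_betwI[where g = "\<lambda>C. (C \<inter> I, C \<inter> J)"]) (use assms(3) in auto)
  have "multilinear c (I \<union> J) z = (\<Sum>(A, B)\<in>Pow I \<times> Pow J. c (A \<union> B) * prod z (A \<union> B))"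
    unfolding multilinear_def by (subst sum.reindex_bij_betw[OF bij, symmetric]) (simp add: case_prod_beta)
  also have "\<dots> = (\<Sum>(A, B)\<in>Pow I \<times> Pow J. c (A \<union> B) * prod z A * prod z B)"
  proof (intro sum.cong refl, clarify)
    fix A B assume "A \<subseteq> I" "B \<subseteq> J"
    then have "prod z (A \<union> B) = prod z A * prod z B"
      using assms by (intro prod.union_disjoint) (auto dest: finite_subset)
    then show "c (A \<union> B) * prod z (A \<union> B) = c (A \<union> B) * prod z A * prod z B"
      by simp
  qed
  also have "\<dots> = (\<Sum>B\<in>Pow J. \<Sum>A\<in>Pow I. c (A \<union> B) * prod z A * prod z B)"
    by (subst sum.swap) (simp add: sum.cartesian_product)
  finally show ?thesis
    by (simp add: multilinear_def sum_distrib_right)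
qed

lemma multilinear_support:
  assumes "\<And>A. c A \<noteq> 0 \<Longrightarrow> A \<subseteq> I" "I \<subseteq> K" "finite K"
  shows "multilinear c K y = multilinear c I y"
  unfolding multilinear_def using assms by (intro sum.mono_neutral_right) auto

context gaussian_product
begin

text \<open>
  The Paley--Zygmund argument. For degree at most \<open>N\<close>, the fourth moment is at most \<open>9 ^ N\<close> times the
  square of the second moment. A polynomial that is small with probability close to 1 would have to
  carry its second moment on an event of tiny probability, which Cauchy--Schwarz excludes.
\<close>

lemma multilinear_small_ball:
  assumes fin: "finite J" and deg: "\<And>A. A \<subseteq> J \<Longrightarrow> card A > N \<Longrightarrow> c A = 0"
    and var: "\<sigma>\<^sup>2 \<le> (\<Sum>A\<in>Pow J. (c A)\<^sup>2 * prod v A)" and "\<sigma> > 0"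
  shows "emeasure (P J) {y \<in> space (P J). \<bar>multilinear c J y\<bar> \<le> \<sigma> / 2} \<le> ennreal (1 - 1 / (2 * 9 ^ N))"
proof -
  interpret Q: prob_space "P J" by (rule prob_space_P)
  define f where "f = multilinear c J"
  have [measurable]: "f \<in> borel_measurable (P J)" unfolding f_def by simp
  define S where "S = (\<Sum>A\<in>Pow J. (c A)\<^sup>2 * prod v A)"
  have S: "\<sigma>\<^sup>2 \<le> S" "0 < \<sigma>\<^sup>2" using var \<open>\<sigma> > 0\<close> by (auto simp: S_def)
  define E where "E = {y \<in> space (P J). \<bar>f y\<bar> > \<sigma> / 2}"
  have E [measurable]: "E \<in> sets (P J)" unfolding E_def by measurable
  have "(\<Sum>A\<in>Pow J. 3 ^ card A * (c A)\<^sup>2 * prod v A) \<le> (\<Sum>A\<in>Pow J. 3 ^ N * ((c A)\<^sup>2 * prod v A))"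
  proof (intro sum_mono)
    fix A assume A: "A \<in> Pow J"
    have "prod v A \<ge> 0" by (intro prod_nonneg) (auto simp: v_pos less_imp_le)
    then have "(3::real) ^ card A * ((c A)\<^sup>2 * prod v A) \<le> 3 ^ N * ((c A)\<^sup>2 * prod v A)" if "card A \<le> N"
      using that by (intro mult_right_mono power_increasing mult_nonneg_nonneg) auto
    then show "3 ^ card A * (c A)\<^sup>2 * prod v A \<le> 3 ^ N * ((c A)\<^sup>2 * prod v A)"
      using deg[of A] A by (cases "card A \<le> N") (auto simp: mult.assoc)
  qed
  then have W: "(\<Sum>A\<in>Pow J. 3 ^ card A * (c A)\<^sup>2 * prod v A) \<le> 3 ^ N * S"
    by (simp add: S_def sum_distrib_left)
  have "(\<Sum>A\<in>Pow J. 3 ^ card A * (c A)\<^sup>2 * prod v A) \<ge> 0"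
    by (intro sum_nonneg mult_nonneg_nonneg prod_nonneg) (auto simp: v_pos less_imp_le)
  then have "(\<Sum>A\<in>Pow J. 3 ^ card A * (c A)\<^sup>2 * prod v A)\<^sup>2 \<le> (3 ^ N * S)\<^sup>2"
    using W by (intro power_mono)
  then have fourth: "(\<integral>\<^sup>+y. ennreal ((f y)^4) \<partial>P J) \<le> ennreal ((3 ^ N * S)\<^sup>2)"
    unfolding f_def by (intro order.trans[OF multilinear_fourth_moment[OF fin]] ennreal_leI)
  define X where "X = (\<integral>\<^sup>+y. ennreal ((f y)\<^sup>2) * indicator E y \<partial>P J)"
  have "ennreal S = (\<integral>\<^sup>+y. ennreal ((f y)\<^sup>2) \<partial>P J)"
    unfolding f_def S_def by (rule multilinear_second_moment[OF fin, symmetric])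
  also have "\<dots> \<le> (\<integral>\<^sup>+y. ennreal (\<sigma>\<^sup>2 / 4) + ennreal ((f y)\<^sup>2) * indicator E y \<partial>P J)"
  proof (intro nn_integral_mono)
    fix y assume "y \<in> space (P J)"
    moreover have "(f y)\<^sup>2 \<le> (\<sigma> / 2)\<^sup>2" if "\<bar>f y\<bar> \<le> \<sigma> / 2"
      using power_mono[OF that, of 2] by simp
    ultimately show "ennreal ((f y)\<^sup>2) \<le> ennreal (\<sigma>\<^sup>2 / 4) + ennreal ((f y)\<^sup>2) * indicator E y"
      by (auto simp: E_def indicator_def power_divide)
  qed
  also have "\<dots> = ennreal (\<sigma>\<^sup>2 / 4) + X"
    unfolding X_def by (subst nn_integral_add) (auto simp: Q.emeasure_space_1)
  finally have low: "ennreal S \<le> ennreal (\<sigma>\<^sup>2 / 4) + X" .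
  have "X\<^sup>2 \<le> (\<integral>\<^sup>+y. (ennreal ((f y)\<^sup>2))\<^sup>2 \<partial>P J) * (\<integral>\<^sup>+y. (indicator E y)\<^sup>2 \<partial>P J)"
    unfolding X_def by (rule Cauchy_Schwarz_nn_integral) measurable
  also have "(\<integral>\<^sup>+y. (indicator E y)\<^sup>2 \<partial>P J) = (\<integral>\<^sup>+y. indicator E y \<partial>P J)"
    by (intro nn_integral_cong) (auto simp: indicator_def)
  also have "\<dots> = ennreal (Q.prob E)"
    by (simp add: Q.emeasure_eq_measure)
  also have "(\<integral>\<^sup>+y. (ennreal ((f y)\<^sup>2))\<^sup>2 \<partial>P J) = (\<integral>\<^sup>+y. ennreal ((f y)^4) \<partial>P J)"
    by (simp add: ennreal_power)
  also have "(\<integral>\<^sup>+y. ennreal ((f y)^4) \<partial>P J) * ennreal (Q.prob E) \<le> ennreal ((3 ^ N * S)\<^sup>2 * Q.prob E)"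
    using mult_right_mono[OF fourth, of "ennreal (Q.prob E)"] by (simp add: ennreal_mult)
  finally have up: "X\<^sup>2 \<le> ennreal ((3 ^ N * S)\<^sup>2 * Q.prob E)" .
  have "X \<noteq> top"
    using up by (auto simp: power2_eq_square ennreal_mult_top top_unique)
  then obtain r where r: "X = ennreal r" "r \<ge> 0" by (cases X) auto
  have "S \<le> \<sigma>\<^sup>2 / 4 + r"
    using low r by (simp flip: ennreal_plus)
  then have "3 / 4 * S \<le> r" using S by simp
  moreover have "S > 0" using S by linarith
  ultimately have "(3 / 4 * S)\<^sup>2 \<le> r\<^sup>2" by (intro power_mono) auto
  also have "r\<^sup>2 \<le> (3 ^ N * S)\<^sup>2 * Q.prob E"
    using up r by (simp add: ennreal_power)
  also have "\<dots> = S\<^sup>2 * (9 ^ N * Q.prob E)"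
    by (simp add: power_mult_distrib power2_eq_square flip: power_mult_distrib)
  finally have "S\<^sup>2 * (9 / 16) \<le> S\<^sup>2 * (9 ^ N * Q.prob E)"
    by (simp add: power_mult_distrib power_divide field_simps)
  \<comment> \<open>\<open>9 / 16 = (3 / 4)\<^sup>2\<close>, because at least three quarters of the second moment sit on \<open>E\<close>.\<close>
  then have "9 / 16 \<le> 9 ^ N * Q.prob E"
    using S by (subst (asm) mult_le_cancel_left_pos) auto
  then have "1 / (2 * 9 ^ N) \<le> Q.prob E"
    by (simp add: field_simps)
  moreover have "Q.prob (space (P J) - E) = 1 - Q.prob E"
    by (rule Q.prob_compl) simp
  moreover have "{y \<in> space (P J). \<bar>multilinear c J y\<bar> \<le> \<sigma> / 2} = space (P J) - E"
    by (auto simp: E_def f_def)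
  ultimately show ?thesis
    by (simp only: Q.emeasure_eq_measure) (intro ennreal_leI, simp)
qed

end

text \<open>
  Given the variables in \<open>K i\<close>, the \<open>i\<close>-th polynomial is small with conditional probability at most
  \<open>1 - 1 / (2 * 9 ^ N)\<close>, whatever the values of these variables: its monomials that consist of \<open>N\<close>
  new variables keep their deterministic coefficients under conditioning, and they alone
  contribute at least \<open>\<sigma>\<^sup>2\<close> to the conditional second moment. The earlier polynomials are functions of
  the variables in \<open>K i\<close>, so that the conditional bounds multiply.
\<close>

lemma (in gaussian_product) multilinear_small_ball_chain:
  assumes fin: "\<And>i. finite (K i)" and mono: "\<And>i. K i \<subseteq> K (Suc i)"
    and c: "\<And>i A. i < L \<Longrightarrow> c i A \<noteq> 0 \<Longrightarrow> card A = N \<and> A \<subseteq> K (Suc i)"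
    and var: "\<And>i. i < L \<Longrightarrow> \<sigma>\<^sup>2 \<le> (\<Sum>A | A \<subseteq> K (Suc i) - K i \<and> card A = N. (c i A)\<^sup>2 * prod v A)"
    and "\<sigma> > 0"
  shows "emeasure (P (K L)) {y \<in> space (P (K L)). \<forall>i<L. \<bar>multilinear (c i) (K L) y\<bar> \<le> \<sigma> / 2}
    \<le> ennreal ((1 - 1 / (2 * 9 ^ N)) ^ L)"
  using c var
proof (induction L)
  case 0
  show ?case
    by (auto intro!: prob_space.emeasure_le_1 prob_space_P)
next
  case (Suc L)
  define q where "q = 1 - 1 / (2 * 9 ^ N :: real)"
  have "(1::real) \<le> 9 ^ N" by simp
  then have "(1::real) \<le> 2 * 9 ^ N" by linarith
  then have q: "q \<ge> 0" unfolding q_def by (simp add: field_simps)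
  define I J where "I = K L" and "J = K (Suc L) - K L"
  have IJ: "I \<inter> J = {}" "I \<union> J = K (Suc L)" "finite I" "finite J"
    using mono[of L] fin by (auto simp: I_def J_def)
  have K_mono: "K i \<subseteq> K j" if "i \<le> j" for i j
    using that lift_Suc_mono_le[of K] mono by blast
  define A where "A = {y \<in> space (P (I \<union> J)). \<forall>i<Suc L. \<bar>multilinear (c i) (I \<union> J) y\<bar> \<le> \<sigma> / 2}"
  define A' where "A' = {x \<in> space (P I). \<forall>i<L. \<bar>multilinear (c i) I x\<bar> \<le> \<sigma> / 2}"
  have A [measurable]: "A \<in> sets (P (I \<union> J))"
    unfolding A_def by measurable
  have A' [measurable]: "A' \<in> sets (P I)"
    unfolding A'_def by measurable
  have IH: "emeasure (P I) A' \<le> ennreal (q ^ L)"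
    unfolding A'_def I_def q_def by (rule Suc.IH[OF Suc.prems]) simp_all
  have "emeasure (P (I \<union> J)) A
      = (\<integral>\<^sup>+x. emeasure (P J) ((\<lambda>y. merge I J (x, y)) -` A \<inter> space (P J)) \<partial>P I)"
    using IJ A by (intro emeasure_fold_integral) auto
  also have "\<dots> \<le> (\<integral>\<^sup>+x. ennreal q * indicator A' x \<partial>P I)"
  proof (intro nn_integral_mono)
    fix x assume x: "x \<in> space (P I)"
    define d where "d B = (\<Sum>A\<in>Pow I. c L (A \<union> B) * prod x A)" for B
    have past: "multilinear (c i) (I \<union> J) (merge I J (x, y)) = multilinear (c i) I x" if "i < L" for i y
    proof -
      have "multilinear (c i) (I \<union> J) (merge I J (x, y)) = multilinear (c i) I (merge I J (x, y))"
      proof (rule multilinear_support)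
        show "A \<subseteq> I" if "c i A \<noteq> 0" for A
          using Suc.prems(1)[of i A] \<open>i < L\<close> that K_mono[of "Suc i" L] by (auto simp: I_def)
      qed (use IJ fin in auto)
      also have "\<dots> = multilinear (c i) I x"
        using IJ by (intro multilinear_cong) auto
      finally show ?thesis .
    qed
    have present: "multilinear (c L) (I \<union> J) (merge I J (x, y)) = multilinear d J y" for y
    proof -
      have "multilinear (c L) (I \<union> J) (merge I J (x, y))
          = multilinear (\<lambda>B. \<Sum>A\<in>Pow I. c L (A \<union> B) * prod (merge I J (x, y)) A) J (merge I J (x, y))"
        using IJ by (intro multilinear_freeze) auto
      also have "(\<lambda>B. \<Sum>A\<in>Pow I. c L (A \<union> B) * prod (merge I J (x, y)) A) = d"
        unfolding d_def by (intro ext sum.cong refl arg_cong2[where f = "(*)"] prod.cong) (auto simp: merge_def subset_iff)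
      also have "multilinear d J (merge I J (x, y)) = multilinear d J y"
        using IJ by (intro multilinear_cong) auto
      finally show ?thesis .
    qed
    \<comment> \<open>A monomial with \<open>N\<close> new variables has no room for a variable from the past.\<close>
    have d_top: "d B = c L B" if "B \<subseteq> J" "card B = N" for B
    proof -
      have "c L (A \<union> B) = 0" if "A \<subseteq> I" "A \<noteq> {}" for A
      proof (rule ccontr)
        assume "c L (A \<union> B) \<noteq> 0"
        then have "card (A \<union> B) = N" using Suc.prems(1)[of L] by auto
        moreover have "card (A \<union> B) = card A + card B"
          using that \<open>B \<subseteq> J\<close> IJ by (intro card_Un_disjoint) (auto dest: finite_subset)
        moreover have "card A > 0" using that IJ by (auto simp: card_gt_0_iff dest: finite_subset)
        ultimately show False using \<open>card B = N\<close> by simp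
      qed
      then have "d B = (\<Sum>A\<in>{{}}. c L (A \<union> B) * prod x A)"
        unfolding d_def using IJ by (intro sum.mono_neutral_right) auto
      then show ?thesis by simp
    qed
    have d_high: "d B = 0" if "B \<subseteq> J" "card B > N" for B
    proof -
      have "c L (A \<union> B) = 0" if "A \<subseteq> I" for A
      proof (rule ccontr)
        assume "c L (A \<union> B) \<noteq> 0"
        then have "card (A \<union> B) = N" using Suc.prems(1)[of L] by auto
        moreover have "card B \<le> card (A \<union> B)"
          using that \<open>B \<subseteq> J\<close> IJ by (intro card_mono) (auto dest: finite_subset)
        ultimately show False using \<open>card B > N\<close> by simp
      qed
      then show ?thesis unfolding d_def by simp
    qed
    have "\<sigma>\<^sup>2 \<le> (\<Sum>B | B \<subseteq> J \<and> card B = N. (c L B)\<^sup>2 * prod v B)"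
      using Suc.prems(2)[of L] by (simp add: J_def)
    also have "\<dots> = (\<Sum>B | B \<subseteq> J \<and> card B = N. (d B)\<^sup>2 * prod v B)"
      by (intro sum.cong) (auto simp: d_top)
    also have "\<dots> \<le> (\<Sum>B\<in>Pow J. (d B)\<^sup>2 * prod v B)"
      using IJ v_pos by (intro sum_mono2 mult_nonneg_nonneg prod_nonneg) (auto simp: less_imp_le)
    finally have small: "emeasure (P J) {y \<in> space (P J). \<bar>multilinear d J y\<bar> \<le> \<sigma> / 2} \<le> ennreal q"
      unfolding q_def using IJ \<open>\<sigma> > 0\<close> d_high by (intro multilinear_small_ball) auto
    show "emeasure (P J) ((\<lambda>y. merge I J (x, y)) -` A \<inter> space (P J)) \<le> ennreal q * indicator A' x"
    proof (cases "x \<in> A'")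
      case True
      have "emeasure (P J) ((\<lambda>y. merge I J (x, y)) -` A \<inter> space (P J))
          \<le> emeasure (P J) {y \<in> space (P J). \<bar>multilinear d J y\<bar> \<le> \<sigma> / 2}"
        by (intro emeasure_mono) (auto simp: A_def present)
      with True small show ?thesis by simp
    next
      case False
      then have "(\<lambda>y. merge I J (x, y)) -` A \<inter> space (P J) = {}"
        using x by (auto simp: A_def A'_def past All_less_Suc)
      then show ?thesis by simp
    qed
  qed
  also have "\<dots> = ennreal q * emeasure (P I) A'"
    by (simp add: nn_integral_cmult)
  also have "\<dots> \<le> ennreal q * ennreal (q ^ L)"
    by (intro mult_left_mono IH) simp
  also have "\<dots> = ennreal (q ^ Suc L)"
    using q by (simp add: ennreal_mult)
  finally show ?case
    unfolding A_def IJ(2) q_def .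
qed

section \<open>Step functions on grids and their coefficients\<close>

lemma strict_mono_on_atMost_le:
  fixes x :: "nat \<Rightarrow> 'b::preorder"
  shows "strict_mono_on {..n} x \<Longrightarrow> j \<le> k \<Longrightarrow> k \<le> n \<Longrightarrow> x j \<le> x k"
  by (cases "j = k") (auto dest!: strict_mono_onD[of _ x j k] intro: less_imp_le)

lemma finite_offdiag_indices [simp]: "finite (offdiag_indices N n)"
  unfolding offdiag_indices_def by (rule finite_subset[of _ "{..<N} \<rightarrow>\<^sub>E {..<n}"]) (auto intro: finite_PiE)

lemma offdiag_indices_less: "i \<in> offdiag_indices N n \<Longrightarrow> p < N \<Longrightarrow> i p < n"
  by (auto simp: offdiag_indices_def)

lemma offdiag_indices_inj: "i \<in> offdiag_indices N n \<Longrightarrow> inj_on i {..<N}"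
  by (auto simp: offdiag_indices_def)

text \<open>
  The common shape of step functions and step integrals. In both, \<open>z p\<close> is additive under subdivision
  of a cell, so that refining the grid can be treated once for both.
\<close>

definition box_sum :: "nat \<Rightarrow> nat \<Rightarrow> ((nat \<Rightarrow> nat) \<Rightarrow> real) \<Rightarrow> (nat \<Rightarrow> nat \<Rightarrow> real) \<Rightarrow> real" where
  "box_sum N n a z = (\<Sum>i\<in>offdiag_indices N n. a i * (\<Prod>p<N. z p (i p)))"

lemma step_function_eq_box_sum:
  "step_function N n x a u = box_sum N n a (\<lambda>p j. indicator {x j<..x (Suc j)} (u p))"
  by (simp add: step_function_def box_sum_def)

lemma step_integral_eq_box_sum:
  "step_integral B N n x a \<omega> = box_sum N n a (\<lambda>p j. B (x (Suc j)) \<omega> - B (x j) \<omega>)"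
  by (simp add: step_integral_def box_sum_def)

lemma box_sum_cong:
  "(\<And>p j. p < N \<Longrightarrow> j < n \<Longrightarrow> z p j = z' p j) \<Longrightarrow> box_sum N n a z = box_sum N n a z'"
  unfolding box_sum_def
  by (intro sum.cong refl arg_cong2[where f = "(*)"] prod.cong) (auto dest: offdiag_indices_less)

text \<open>
  The 0-1 factors select the fine multi-indices \<open>k\<close> whose box lies inside the box of \<open>i\<close>; a fine cell
  outside the coarse grid receives the coefficient 0.
\<close>

definition refine_coeff ::
    "nat \<Rightarrow> nat \<Rightarrow> (nat \<Rightarrow> nat) \<Rightarrow> ((nat \<Rightarrow> nat) \<Rightarrow> real) \<Rightarrow> (nat \<Rightarrow> nat) \<Rightarrow> real" where
  "refine_coeff N n \<phi> a k =
     (\<Sum>i\<in>offdiag_indices N n. a i * (\<Prod>p<N. of_bool (k p \<in> {\<phi> (i p)..<\<phi> (Suc (i p))})))"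

text \<open>
  Expanding the product of the sums over sub-cells gives all fine boxes inside a coarse one. These
  avoid the diagonals because cells with distinct coarse indices are disjoint.
\<close>

lemma box_sum_refine:
  assumes \<phi>: "strict_mono_on {..n} \<phi>" and "\<phi> n \<le> n'"
  shows "box_sum N n' (refine_coeff N n \<phi> a) z = box_sum N n a (\<lambda>p j. \<Sum>k\<in>{\<phi> j..<\<phi> (Suc j)}. z p k)"
proof -
  define cell where "cell j = {\<phi> j..<\<phi> (Suc j)}" for j
  have mono: "\<phi> j \<le> \<phi> k" if "j \<le> k" "k \<le> n" for j k
    using \<phi> that by (rule strict_mono_on_atMost_le)
  have cell_less: "k < n'" if "k \<in> cell j" "j < n" for j k
    using that mono[of "Suc j" n] \<open>\<phi> n \<le> n'\<close> by (auto simp: cell_def)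
  have disj: "j = j'" if "k \<in> cell j" "k \<in> cell j'" "j < n" "j' < n" for j j' k
  proof (rule ccontr)
    assume "j \<noteq> j'"
    then have "Suc j \<le> j' \<or> Suc j' \<le> j" by auto
    then show False
      using that mono[of "Suc j" j'] mono[of "Suc j'" j] by (auto simp: cell_def)
  qed
  have fibre: "(\<Sum>k\<in>offdiag_indices N n'. \<Prod>p<N. of_bool (k p \<in> cell (i p)) * z p (k p))
      = (\<Prod>p<N. \<Sum>k\<in>cell (i p). z p k)" if i: "i \<in> offdiag_indices N n" for i
  proof -
    have "(\<Prod>p<N. \<Sum>k\<in>cell (i p). z p k) = (\<Sum>k\<in>PiE {..<N} (\<lambda>p. cell (i p)). \<Prod>p<N. z p (k p))"
      by (rule prod_sum_PiE) (auto simp: cell_def)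
    also have "\<dots> = (\<Sum>k\<in>offdiag_indices N n'. \<Prod>p<N. of_bool (k p \<in> cell (i p)) * z p (k p))"
    proof (rule sum.mono_neutral_cong_left)
      show "PiE {..<N} (\<lambda>p. cell (i p)) \<subseteq> offdiag_indices N n'"
      proof
        fix k assume k: "k \<in> PiE {..<N} (\<lambda>p. cell (i p))"
        have "inj_on k {..<N}"
        proof (rule inj_onI)
          fix p q assume "p \<in> {..<N}" "q \<in> {..<N}" "k p = k q"
          then have "i p = i q"
            using k disj[of "k p" "i p" "i q"] offdiag_indices_less[OF i] by (auto simp: PiE_def Pi_def)
          then show "p = q"
            using offdiag_indices_inj[OF i] \<open>p \<in> {..<N}\<close> \<open>q \<in> {..<N}\<close> by (auto dest: inj_onD)
        qed
        then show "k \<in> offdiag_indices N n'"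
          using k cell_less offdiag_indices_less[OF i] by (auto simp: offdiag_indices_def PiE_def Pi_def)
      qed
      show "\<forall>k\<in>offdiag_indices N n' - PiE {..<N} (\<lambda>p. cell (i p)).
          (\<Prod>p<N. of_bool (k p \<in> cell (i p)) * z p (k p)) = 0"
      proof
        fix k assume k: "k \<in> offdiag_indices N n' - PiE {..<N} (\<lambda>p. cell (i p))"
        then obtain p where "p < N" "k p \<notin> cell (i p)"
          by (auto simp: offdiag_indices_def PiE_def Pi_def)
        then show "(\<Prod>p<N. of_bool (k p \<in> cell (i p)) * z p (k p)) = 0"
          by (intro prod_zero) auto
      qed
      show "(\<Prod>p<N. z p (k p)) = (\<Prod>p<N. of_bool (k p \<in> cell (i p)) * z p (k p))"
        if "k \<in> PiE {..<N} (\<lambda>p. cell (i p))" for k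
        using that by (intro prod.cong) (auto simp: PiE_def Pi_def)
    qed simp
    finally show ?thesis by simp
  qed
  have "box_sum N n' (refine_coeff N n \<phi> a) z
      = (\<Sum>k\<in>offdiag_indices N n'. \<Sum>i\<in>offdiag_indices N n. a i * (\<Prod>p<N. of_bool (k p \<in> cell (i p)) * z p (k p)))"
    unfolding box_sum_def refine_coeff_def cell_def by (simp add: sum_distrib_right prod.distrib mult.assoc)
  also have "\<dots> = (\<Sum>i\<in>offdiag_indices N n. a i *
      (\<Sum>k\<in>offdiag_indices N n'. \<Prod>p<N. of_bool (k p \<in> cell (i p)) * z p (k p)))"
    by (subst sum.swap) (simp add: sum_distrib_left)
  also have "\<dots> = (\<Sum>i\<in>offdiag_indices N n. a i * (\<Prod>p<N. \<Sum>k\<in>cell (i p). z p k))"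
    by (intro sum.cong refl) (simp only: fibre)
  finally show ?thesis
    by (simp add: box_sum_def cell_def)
qed

lemma sum_indicator_cells:
  assumes x: "strict_mono_on {..n} (x :: nat \<Rightarrow> real)" and "m \<le> m'" "m' \<le> n"
  shows "(\<Sum>k\<in>{m..<m'}. indicator {x k<..x (Suc k)} (u::real)) = (indicator {x m<..x m'} u :: real)"
proof -
  have ind: "(indicator {x k<..x l} u :: real) = indicator {..x l} u - indicator {..x k} u"
    if "k \<le> l" "l \<le> n" for k l
  proof -
    have "x k \<le> x l" using x that by (rule strict_mono_on_atMost_le)
    then show ?thesis by (auto simp: indicator_def)
  qed
  have "(\<Sum>k\<in>{m..<m'}. indicator {x k<..x (Suc k)} u :: real)
      = (\<Sum>k\<in>{m..<m'}. indicator {..x (Suc k)} u - indicator {..x k} u)"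
    using \<open>m' \<le> n\<close> by (intro sum.cong refl ind) auto
  also have "\<dots> = indicator {..x m'} u - indicator {..x m} u"
    using \<open>m \<le> m'\<close> by (rule sum_Suc_diff')
  also have "\<dots> = indicator {x m<..x m'} u"
    using ind[of m m'] assms by simp
  finally show ?thesis .
qed

lemma step_function_refine:
  assumes x: "strict_mono_on {..n} x" and x': "strict_mono_on {..n'} x'"
    and sub: "x ` {..n} \<subseteq> x' ` {..n'}"
  shows "\<exists>a'. (\<forall>u. step_function N n' x' a' u = step_function N n x a u)
    \<and> (\<forall>B (\<omega>::'w). step_integral B N n' x' a' \<omega> = step_integral B N n x a \<omega>)"
proof -
  define \<phi> where "\<phi> j = inv_into {..n'} x' (x j)" for j
  have \<phi>: "x' (\<phi> j) = x j" "\<phi> j \<le> n'" if "j \<le> n" for j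
    using f_inv_into_f[of "x j" x' "{..n'}"] inv_into_into[of "x j" x' "{..n'}"] sub that
    by (auto simp: \<phi>_def image_subset_iff)
  have \<phi>_mono: "strict_mono_on {..n} \<phi>"
  proof (rule strict_mono_onI)
    fix r s assume rs: "r \<in> {..n}" "s \<in> {..n}" "r < s"
    have "x' (\<phi> r) < x' (\<phi> s)"
      using strict_mono_onD[OF x, of r s] rs \<phi> by auto
    then show "\<phi> r < \<phi> s"
      using strict_mono_onD[OF x', of "\<phi> s" "\<phi> r"] rs \<phi>[of r] \<phi>[of s]
      by (cases "\<phi> r" "\<phi> s" rule: linorder_cases) auto
  qed
  have less: "\<phi> j \<le> \<phi> (Suc j)" if "j < n" for j
    using that by (intro strict_mono_on_atMost_le[OF \<phi>_mono]) auto
  show ?thesis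
  proof (intro exI[of _ "refine_coeff N n \<phi> a"] conjI allI)
    show "step_function N n' x' (refine_coeff N n \<phi> a) u = step_function N n x a u" for u
      unfolding step_function_eq_box_sum box_sum_refine[OF \<phi>_mono \<phi>(2)[OF order_refl]]
      using less \<phi> by (intro box_sum_cong) (simp add: sum_indicator_cells[OF x'] Suc_leI)
    show "step_integral B N n' x' (refine_coeff N n \<phi> a) \<omega> = step_integral B N n x a \<omega>" for B and \<omega> :: 'w
      unfolding step_integral_eq_box_sum box_sum_refine[OF \<phi>_mono \<phi>(2)[OF order_refl]]
    proof (intro box_sum_cong)
      fix p j :: nat assume "j < n"
      have "(\<Sum>k = \<phi> j..<\<phi> (Suc j). B (x' (Suc k)) \<omega> - B (x' k) \<omega>) = B (x' (\<phi> (Suc j))) \<omega> - B (x' (\<phi> j)) \<omega>"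
        using less[OF \<open>j < n\<close>] by (rule sum_Suc_diff'[of _ _ "\<lambda>k. B (x' k) \<omega>"])
      then show "(\<Sum>k = \<phi> j..<\<phi> (Suc j). B (x' (Suc k)) \<omega> - B (x' k) \<omega>) = B (x (Suc j)) \<omega> - B (x j) \<omega>"
        using \<phi> \<open>j < n\<close> by simp
    qed
  qed
qed

lemma finite_set_as_grid:
  assumes "finite (T :: real set)" "T \<noteq> {}"
  obtains n :: nat and x where "strict_mono_on {..n} x" "x ` {..n} = T"
proof -
  define x where "x k = sorted_list_of_set T ! k" for k
  have len: "{..card T - 1} = {..<length (sorted_list_of_set T)}"
  proof -
    have "card T > 0" using assms by (simp add: card_gt_0_iff)
    then show ?thesis by auto
  qed
  show thesis
  proof
    show "strict_mono_on {..card T - 1} x"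
      unfolding len x_def by (intro strict_mono_onI sorted_wrt_nth_less[OF strict_sorted_list_of_set]) auto
    show "x ` {..card T - 1} = T"
      using assms(1) nth_image[of "length (sorted_list_of_set T)" "sorted_list_of_set T"]
      unfolding len x_def by (simp add: atLeast0LessThan)
  qed
qed

text \<open>
  All enumerations \<open>i\<close> of the same set \<open>A\<close> of cells lead to the same monomial in the increments.
\<close>

definition coeff_sum :: "nat \<Rightarrow> nat \<Rightarrow> ((nat \<Rightarrow> nat) \<Rightarrow> real) \<Rightarrow> nat set \<Rightarrow> real" where
  "coeff_sum N n a A = (\<Sum>i | i \<in> offdiag_indices N n \<and> i ` {..<N} = A. a i)"

lemma coeff_sum_support:
  assumes "coeff_sum N n a A \<noteq> 0"
  shows "card A = N" "\<exists>i\<in>offdiag_indices N n. a i \<noteq> 0 \<and> i ` {..<N} = A"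
proof -
  show "\<exists>i\<in>offdiag_indices N n. a i \<noteq> 0 \<and> i ` {..<N} = A"
    using assms unfolding coeff_sum_def by (metis (mono_tags, lifting) mem_Collect_eq sum.neutral)
  then show "card A = N"
    by (auto dest!: offdiag_indices_inj simp: card_image)
qed

lemma sum_offdiag_eq_sum_subsets:
  "(\<Sum>i | i \<in> offdiag_indices N n \<and> i ` {..<N} \<subseteq> T. a i * (\<Prod>p<N. y (i p)))
    = (\<Sum>A\<in>Pow (T \<inter> {..<n}). coeff_sum N n a A * prod y A)"
proof -
  define D where "D = {i \<in> offdiag_indices N n. i ` {..<N} \<subseteq> T}"
  have "(\<Sum>i\<in>D. a i * (\<Prod>p<N. y (i p)))
      = (\<Sum>A\<in>Pow (T \<inter> {..<n}). \<Sum>i | i \<in> D \<and> i ` {..<N} = A. a i * (\<Prod>p<N. y (i p)))"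
    by (rule sum.group[symmetric]) (auto simp: D_def dest: offdiag_indices_less)
  also have "\<dots> = (\<Sum>A\<in>Pow (T \<inter> {..<n}). coeff_sum N n a A * prod y A)"
  proof (intro sum.cong refl)
    fix A assume A: "A \<in> Pow (T \<inter> {..<n})"
    have "(\<Sum>i | i \<in> D \<and> i ` {..<N} = A. a i * (\<Prod>p<N. y (i p)))
        = (\<Sum>i | i \<in> D \<and> i ` {..<N} = A. a i * prod y A)"
      by (intro sum.cong refl) (auto simp: D_def prod.reindex offdiag_indices_inj)
    moreover have "{i. i \<in> D \<and> i ` {..<N} = A} = {i. i \<in> offdiag_indices N n \<and> i ` {..<N} = A}"
      using A by (auto simp: D_def)
    ultimately show "(\<Sum>i | i \<in> D \<and> i ` {..<N} = A. a i * (\<Prod>p<N. y (i p))) = coeff_sum N n a A * prod y A"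
      by (simp add: coeff_sum_def sum_distrib_right)
  qed
  finally show ?thesis by (simp add: D_def)
qed

lemma step_integral_eq_multilinear:
  "step_integral B N n x a \<omega> = multilinear (coeff_sum N n a) {..<n} (\<lambda>j. B (x (Suc j)) \<omega> - B (x j) \<omega>)"
proof -
  have "{i \<in> offdiag_indices N n. i ` {..<N} \<subseteq> UNIV} = offdiag_indices N n" by auto
  then show ?thesis
    using sum_offdiag_eq_sum_subsets[where T = UNIV and a = a and y = "\<lambda>j. B (x (Suc j)) \<omega> - B (x j) \<omega>" and N = N and n = n]
    by (simp add: step_integral_def multilinear_def)
qed

text \<open>
  The left side is the second moment of a step integral, the sum on the right the squared norm of the
  step function. Cauchy--Schwarz over the enumerations of a set of size \<open>N\<close> links them; the crude
  count \<open>N ^ N\<close> of maps from \<open>{..<N}\<close> to the set is enough.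
\<close>

lemma sum_coeff_sum_square_le:
  assumes "\<And>j. v j \<ge> 0"
  shows "(\<Sum>A\<in>Pow {..<n}. (coeff_sum N n a A)\<^sup>2 * prod v A)
    \<le> real N ^ N * (\<Sum>i\<in>offdiag_indices N n. (a i)\<^sup>2 * (\<Prod>p<N. v (i p)))"
proof -
  have "(coeff_sum N n a A)\<^sup>2 \<le> real N ^ N * coeff_sum N n (\<lambda>i. (a i)\<^sup>2) A" if "A \<in> Pow {..<n}" for A
  proof (cases "coeff_sum N n a A = 0")
    case True
    then show ?thesis
      unfolding coeff_sum_def by (auto intro!: mult_nonneg_nonneg sum_nonneg)
  next
    case False
    define S where "S = {i \<in> offdiag_indices N n. i ` {..<N} = A}"
    have "finite A" using that by (auto dest: finite_subset)
    have "card S \<le> card ({..<N} \<rightarrow>\<^sub>E A)"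
      using \<open>finite A\<close> by (intro card_mono finite_PiE) (auto simp: S_def offdiag_indices_def PiE_def Pi_def)
    also have "\<dots> = N ^ N"
      using coeff_sum_support(1)[OF False] by (simp add: card_PiE)
    finally have "real (card S) \<le> real N ^ N"
      by (metis of_nat_le_iff of_nat_power)
    have "(coeff_sum N n a A)\<^sup>2 \<le> real (card S) * (\<Sum>i\<in>S. (a i)\<^sup>2)"
      using sum_squared_le_sum_of_squares[of a S] by (simp add: coeff_sum_def S_def mult.commute)
    also have "\<dots> \<le> real N ^ N * (\<Sum>i\<in>S. (a i)\<^sup>2)"
      using \<open>real (card S) \<le> real N ^ N\<close> by (intro mult_right_mono sum_nonneg) auto
    finally show ?thesis
      by (simp add: coeff_sum_def S_def)
  qed
  then have "(\<Sum>A\<in>Pow {..<n}. (coeff_sum N n a A)\<^sup>2 * prod v A)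
      \<le> (\<Sum>A\<in>Pow {..<n}. real N ^ N * coeff_sum N n (\<lambda>i. (a i)\<^sup>2) A * prod v A)"
    using assms by (intro sum_mono mult_right_mono prod_nonneg) auto
  also have "\<dots> = real N ^ N * (\<Sum>i\<in>offdiag_indices N n. (a i)\<^sup>2 * (\<Prod>p<N. v (i p)))"
    using sum_offdiag_eq_sum_subsets[where T = UNIV and a = "\<lambda>i. (a i)\<^sup>2" and y = v and N = N and n = n]
    by (simp add: sum_distrib_left mult.assoc)
  finally show ?thesis .
qed

lemma cells_disjoint:
  assumes "strict_mono_on {..n} (x :: nat \<Rightarrow> real)" "j < n" "k < n" "j \<noteq> k"
  shows "{x j<..x (Suc j)} \<inter> {x k<..x (Suc k)} = {}"
proof -
  have mono: "x j \<le> x k" if "j \<le> k" "k \<le> n" for j k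
    using assms(1) that by (rule strict_mono_on_atMost_le)
  have "Suc j \<le> k \<or> Suc k \<le> j" using assms by auto
  then show ?thesis
    using mono[of "Suc j" k] mono[of "Suc k" j] assms by (auto simp: not_less)
qed

text \<open>
  Distinct boxes are disjoint, so no cross terms remain.
\<close>

lemma step_function_square:
  assumes x: "strict_mono_on {..n} x"
  shows "(step_function N n x a u)\<^sup>2
    = (\<Sum>i\<in>offdiag_indices N n. (a i)\<^sup>2 * (\<Prod>p<N. indicator {x (i p)<..x (Suc (i p))} (u p)))"
proof -
  define I where "I i = (\<Prod>p<N. indicator {x (i p)<..x (Suc (i p))} (u p) :: real)" for i :: "nat \<Rightarrow> nat"
  have idem: "I i * I i = I i" for i
    unfolding I_def prod.distrib[symmetric] by (intro prod.cong) (auto simp: indicator_def)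
  have orth: "I i * I k = 0" if ik: "i \<in> offdiag_indices N n" "k \<in> offdiag_indices N n" "i \<noteq> k" for i k
  proof -
    obtain p where p: "p < N" "i p \<noteq> k p"
      using ik unfolding offdiag_indices_def by (metis (no_types, lifting) PiE_ext lessThan_iff mem_Collect_eq)
    then have "indicator {x (i p)<..x (Suc (i p))} (u p) * indicator {x (k p)<..x (Suc (k p))} (u p) = (0::real)"
      using cells_disjoint[OF x _ _ p(2)] ik offdiag_indices_less by (auto simp: indicator_def)
    then show ?thesis
      unfolding I_def prod.distrib[symmetric] using p(1) by (intro prod_zero) auto
  qed
  have "(step_function N n x a u)\<^sup>2 = (\<Sum>i\<in>offdiag_indices N n. \<Sum>k\<in>offdiag_indices N n. a i * I i * (a k * I k))"
    by (simp add: step_function_def I_def power2_eq_square sum_product)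
  also have "\<dots> = (\<Sum>i\<in>offdiag_indices N n. \<Sum>k\<in>offdiag_indices N n. if k = i then (a i)\<^sup>2 * I i else 0)"
  proof (intro sum.cong refl)
    fix i k assume "i \<in> offdiag_indices N n" "k \<in> offdiag_indices N n"
    have "a i * I i * (a k * I k) = a i * a k * (I i * I k)" by (simp only: mult_ac)
    then show "a i * I i * (a k * I k) = (if k = i then (a i)\<^sup>2 * I i else 0)"
      using orth[of i k] \<open>i \<in> _\<close> \<open>k \<in> _\<close>
      by (cases "k = i") (simp_all add: idem power2_eq_square del: mult_eq_0_iff)
  qed
  also have "\<dots> = (\<Sum>i\<in>offdiag_indices N n. (a i)\<^sup>2 * I i)"
    by simp
  finally show ?thesis by (simp add: I_def)
qed

abbreviation lebesgue_power :: "nat \<Rightarrow> (nat \<Rightarrow> real) measure" where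
  "lebesgue_power N \<equiv> (\<Pi>\<^sub>M p\<in>{..<N}. lborel)"

lemma product_sigma_finite_lborel: "product_sigma_finite (\<lambda>p::nat. lborel :: real measure)"
  by (rule product_sigma_finite.intro) (rule sigma_finite_lborel)

lemma borel_measurable_step_function [measurable]:
  "step_function N n x a \<in> borel_measurable (lebesgue_power N)"
  unfolding step_function_def by measurable

lemma box_indicator_integral:
  assumes "\<And>p. p < N \<Longrightarrow> l p \<le> (r p :: real)"
  shows "integrable (lebesgue_power N) (\<lambda>u. \<Prod>p<N. indicator {l p<..r p} (u p) :: real)"
    and "(\<integral>u. (\<Prod>p<N. indicator {l p<..r p} (u p)) \<partial>lebesgue_power N) = (\<Prod>p<N. r p - l p)"
proof -
  interpret product_sigma_finite "\<lambda>p::nat. lborel :: real measure"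
    by (rule product_sigma_finite_lborel)
  have int: "integrable lborel (indicator {l p<..r p} :: real \<Rightarrow> real)" if "p < N" for p
    using assms[OF that] by (simp add: integrable_indicator_iff)
  then show "integrable (lebesgue_power N) (\<lambda>u. \<Prod>p<N. indicator {l p<..r p} (u p) :: real)"
    by (intro product_integrable_prod) auto
  show "(\<integral>u. (\<Prod>p<N. indicator {l p<..r p} (u p)) \<partial>lebesgue_power N) = (\<Prod>p<N. r p - l p)"
    using int assms by (subst product_integral_prod) auto
qed

lemma step_function_norm:
  assumes x: "strict_mono_on {..n} x"
  shows "(\<integral>\<^sup>+u. ennreal ((step_function N n x a u)\<^sup>2) \<partial>lebesgue_power N)
    = ennreal (\<Sum>i\<in>offdiag_indices N n. (a i)\<^sup>2 * (\<Prod>p<N. x (Suc (i p)) - x (i p)))"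
proof -
  have le: "x (i p) \<le> x (Suc (i p))" if "i \<in> offdiag_indices N n" "p < N" for i p
    using offdiag_indices_less[OF that] by (intro strict_mono_on_atMost_le[OF x]) auto
  have "has_bochner_integral (lebesgue_power N) (\<lambda>u. (step_function N n x a u)\<^sup>2)
      (\<Sum>i\<in>offdiag_indices N n. (a i)\<^sup>2 * (\<Prod>p<N. x (Suc (i p)) - x (i p)))"
    unfolding step_function_square[OF x] using le
    by (intro has_bochner_integral_sum has_bochner_integral_mult_right)
       (auto simp: has_bochner_integral_iff box_indicator_integral)
  then show ?thesis
    by (intro nn_integral_eq_integral[THEN trans]) (auto simp: has_bochner_integral_iff)
qed

text \<open>
  Integrating over a cube that is a union of cells isolates the coefficients of the monomials in the
  increments over that cube. In this way a lower bound for the integral of the integrand becomes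
  one for the coefficients of the polynomial that represents its Wiener integral.
\<close>

lemma step_function_box_integral:
  fixes N :: nat
  assumes x: "strict_mono_on {..n} x" and m: "m \<le> m'" "m' \<le> n"
  defines "C \<equiv> \<lambda>u. \<Prod>p<N. indicator {x m<..x m'} (u p) :: real"
  shows "has_bochner_integral (lebesgue_power N) (\<lambda>u. step_function N n x a u * C u)
    (\<Sum>A\<in>Pow {m..<m'}. coeff_sum N n a A * (\<Prod>j\<in>A. x (Suc j) - x j))"
proof -
  define D where "D = {i. i \<in> offdiag_indices N n \<and> i ` {..<N} \<subseteq> {m..<m'}}"
  have [simp]: "finite D" unfolding D_def by (rule finite_subset[of _ "offdiag_indices N n"]) auto
  have mono: "x j \<le> x k" if "j \<le> k" "k \<le> n" for j k
    using x that by (rule strict_mono_on_atMost_le)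
  have cell: "indicator {x j<..x (Suc j)} u * indicator {x m<..x m'} u
      = (if j \<in> {m..<m'} then indicator {x j<..x (Suc j)} u else (0::real))" if "j < n" for j u
    using m that mono[of m j] mono[of "Suc j" m'] mono[of "Suc j" m] mono[of m' j]
    by (auto simp: indicator_def not_less)
  have "step_function N n x a u * C u = (\<Sum>i\<in>D. a i * (\<Prod>p<N. indicator {x (i p)<..x (Suc (i p))} (u p)))" for u
  proof -
    have "step_function N n x a u * C u = (\<Sum>i\<in>offdiag_indices N n. a i *
        (\<Prod>p<N. if i p \<in> {m..<m'} then indicator {x (i p)<..x (Suc (i p))} (u p) else 0))"
      unfolding step_function_def C_def sum_distrib_right mult.assoc prod.distrib[symmetric]
      by (intro sum.cong refl arg_cong2[where f = "(*)"] prod.cong cell) (auto dest: offdiag_indices_less)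
    also have "\<dots> = (\<Sum>i\<in>D. a i * (\<Prod>p<N. if i p \<in> {m..<m'} then indicator {x (i p)<..x (Suc (i p))} (u p) else 0))"
    proof (rule sum.mono_neutral_right)
      show "\<forall>i\<in>offdiag_indices N n - D. a i *
          (\<Prod>p<N. if i p \<in> {m..<m'} then indicator {x (i p)<..x (Suc (i p))} (u p) else 0) = 0"
        unfolding D_def by (intro ballI mult_eq_0_iff[THEN iffD2] disjI2 prod_zero) auto
    qed (auto simp: D_def)
    also have "\<dots> = (\<Sum>i\<in>D. a i * (\<Prod>p<N. indicator {x (i p)<..x (Suc (i p))} (u p)))"
      by (intro sum.cong refl arg_cong2[where f = "(*)"] prod.cong) (auto simp: D_def)
    finally show ?thesis .
  qed
  moreover have "has_bochner_integral (lebesgue_power N)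
      (\<lambda>u. \<Sum>i\<in>D. a i * (\<Prod>p<N. indicator {x (i p)<..x (Suc (i p))} (u p)))
      (\<Sum>i\<in>D. a i * (\<Prod>p<N. x (Suc (i p)) - x (i p)))"
    using mono by (intro has_bochner_integral_sum has_bochner_integral_mult_right)
       (auto simp: has_bochner_integral_iff D_def dest: offdiag_indices_less
         intro!: box_indicator_integral Suc_leI)
  moreover have "(\<Sum>i\<in>D. a i * (\<Prod>p<N. x (Suc (i p)) - x (i p)))
      = (\<Sum>A\<in>Pow {m..<m'}. coeff_sum N n a A * (\<Prod>j\<in>A. x (Suc j) - x j))"
  proof -
    have "{m..<m'} \<inter> {..<n} = {m..<m'}" using m by auto
    then show ?thesis
      using sum_offdiag_eq_sum_subsets[where T = "{m..<m'}" and a = a and y = "\<lambda>j. x (Suc j) - x j" and N = N and n = n] by (simp add: D_def)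
  qed
  ultimately show ?thesis by simp
qed

text \<open>
  Multi-indices are cut off at the grid point \<open>m\<close>, so that the resulting step integral depends on
  Brownian increments before that point only.
\<close>

definition truncate_coeff :: "nat \<Rightarrow> nat \<Rightarrow> ((nat \<Rightarrow> nat) \<Rightarrow> real) \<Rightarrow> (nat \<Rightarrow> nat) \<Rightarrow> real" where
  "truncate_coeff N m a i = (if \<forall>p<N. i p < m then a i else 0)"

lemma step_function_truncate:
  assumes x: "strict_mono_on {..n} x" and "m \<le> n"
  shows "step_function N n x (truncate_coeff N m a) u
    = (if \<forall>p<N. u p \<le> x m then step_function N n x a u else 0)"
proof -
  define I where "I i = (\<Prod>p<N. indicator {x (i p)<..x (Suc (i p))} (u p) :: real)" for i :: "nat \<Rightarrow> nat"
  have mono: "x j \<le> x k" if "j \<le> k" "k \<le> n" for j k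
    using x that by (rule strict_mono_on_atMost_le)
  have "truncate_coeff N m a i * I i = (if \<forall>p<N. u p \<le> x m then a i * I i else 0)"
    if i: "i \<in> offdiag_indices N n" for i
  proof (cases "\<exists>p<N. u p \<notin> {x (i p)<..x (Suc (i p))}")
    case True
    then have "I i = 0" unfolding I_def by (intro prod_zero) (auto simp: indicator_def)
    then show ?thesis by simp
  next
    case False
    have "i p < m \<longleftrightarrow> u p \<le> x m" if "p < N" for p
    proof
      assume "i p < m"
      then show "u p \<le> x m"
        using False that mono[of "Suc (i p)" m] \<open>m \<le> n\<close> by fastforce
    next
      assume "u p \<le> x m"
      then show "i p < m"
        using False that mono[of m "i p"] offdiag_indices_less[OF i that] by (cases "i p < m") force+
    qed
    then show ?thesis by (auto simp: truncate_coeff_def)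
  qed
  then have "step_function N n x (truncate_coeff N m a) u
      = (\<Sum>i\<in>offdiag_indices N n. if \<forall>p<N. u p \<le> x m then a i * I i else 0)"
    unfolding step_function_def I_def by (intro sum.cong) auto
  also have "\<dots> = (if \<forall>p<N. u p \<le> x m then \<Sum>i\<in>offdiag_indices N n. a i * I i else 0)"
  proof -
    have "(\<Sum>i\<in>offdiag_indices N n. if Q then f i else 0) = (if Q then \<Sum>i\<in>offdiag_indices N n. f i else 0)"
      for Q and f :: "(nat \<Rightarrow> nat) \<Rightarrow> real" by simp
    then show ?thesis .
  qed
  finally show ?thesis
    by (simp only: step_function_def I_def)
qed

text \<open>
  Expanding the power of the sum produces each product \<open>prod v A\<close> at least once.
\<close>

lemma sum_subset_products_le:
  fixes v :: "'i \<Rightarrow> real"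
  assumes "finite J" "\<And>j. v j \<ge> 0"
  shows "(\<Sum>A | A \<subseteq> J \<and> card A = N. prod v A) \<le> (sum v J) ^ N"
  using assms(1)
proof (induction J arbitrary: N)
  case empty
  have "{A :: 'i set. A \<subseteq> {} \<and> card A = N} = (if N = 0 then {{}} else {})" by auto
  then show ?case by (cases N) auto
next
  case (insert j J)
  show ?case
  proof (cases N)
    case 0
    have "{A. A \<subseteq> insert j J \<and> card A = 0} = {{}}"
      using insert.hyps(1) by (auto simp: card_eq_0_iff dest: finite_subset)
    then show ?thesis using 0 by simp
  next
    case (Suc M)
    have split: "(\<Sum>A | A \<subseteq> K \<and> Q A. f A) = (\<Sum>A\<in>Pow K. if Q A then f A else 0)"
      if "finite K" for K :: "'i set" and Q and f :: "'i set \<Rightarrow> real"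
    proof -
      have "{A. A \<subseteq> K \<and> Q A} = Pow K \<inter> {A. Q A}" by auto
      then show ?thesis using that by (simp add: sum.inter_restrict)
    qed
    have inc: "card (insert j A) = N \<longleftrightarrow> card A = M" if "A \<subseteq> J" for A
      using that insert.hyps Suc by (subst card_insert_disjoint) (auto dest: finite_subset)
    have "(\<Sum>A | A \<subseteq> insert j J \<and> card A = N. prod v A)
        = (\<Sum>A | A \<subseteq> J \<and> card A = N. prod v A) + (\<Sum>A\<in>Pow J. if card (insert j A) = N then prod v (insert j A) else 0)"
      using insert.hyps by (simp add: split sum_Pow_insert del: Pow_insert)
    also have "(\<Sum>A\<in>Pow J. if card (insert j A) = N then prod v (insert j A) else 0)
        = v j * (\<Sum>A | A \<subseteq> J \<and> card A = M. prod v A)"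
      unfolding split[OF insert.hyps(1)] sum_distrib_left
      using insert.hyps by (intro sum.cong refl) (simp add: inc prod_insert_subset)
    also have "(\<Sum>A | A \<subseteq> J \<and> card A = N. prod v A) + v j * (\<Sum>A | A \<subseteq> J \<and> card A = M. prod v A)
        \<le> sum v J ^ N + v j * sum v J ^ M"
      using insert.IH assms(2) by (intro add_mono mult_left_mono) auto
    also have "\<dots> = sum v J ^ M * (v j + sum v J)"
      by (simp add: Suc algebra_simps)
    also have "\<dots> \<le> (v j + sum v J) ^ M * (v j + sum v J)"
      using assms(2) by (intro mult_right_mono power_mono add_nonneg_nonneg sum_nonneg) auto
    finally show ?thesis
      using insert.hyps Suc by (simp add: mult.commute)
  qed
qed

section \<open>Adapted approximation of multiple Wiener integrals\<close>

lemma nn_integral_square_diff_le: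
  assumes [measurable]: "f \<in> borel_measurable M" "g \<in> borel_measurable M" "h \<in> borel_measurable M"
    and "(\<integral>\<^sup>+x. ennreal ((f x - g x)\<^sup>2) \<partial>M) \<le> ennreal a" "(\<integral>\<^sup>+x. ennreal ((g x - h x)\<^sup>2) \<partial>M) \<le> ennreal b"
    and "0 \<le> a" "0 \<le> b"
  shows "(\<integral>\<^sup>+x. ennreal ((f x - h x)\<^sup>2) \<partial>M) \<le> ennreal (2 * a + 2 * b)"
proof -
  have sq: "(r - t)\<^sup>2 \<le> 2 * (r - s)\<^sup>2 + 2 * (s - t)\<^sup>2" for r s t :: real
    using zero_le_power2[of "(r - s) - (s - t)"] by (simp add: power2_eq_square algebra_simps)
  have "(\<integral>\<^sup>+x. ennreal ((f x - h x)\<^sup>2) \<partial>M)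
      \<le> (\<integral>\<^sup>+x. 2 * ennreal ((f x - g x)\<^sup>2) + 2 * ennreal ((g x - h x)\<^sup>2) \<partial>M)"
  proof (intro nn_integral_mono)
    fix x
    have "ennreal ((f x - h x)\<^sup>2) \<le> ennreal (2 * (f x - g x)\<^sup>2 + 2 * (g x - h x)\<^sup>2)"
      by (intro ennreal_leI sq)
    then show "ennreal ((f x - h x)\<^sup>2) \<le> 2 * ennreal ((f x - g x)\<^sup>2) + 2 * ennreal ((g x - h x)\<^sup>2)"
      by (simp add: ennreal_plus ennreal_mult)
  qed
  also have "\<dots> = 2 * (\<integral>\<^sup>+x. ennreal ((f x - g x)\<^sup>2) \<partial>M) + 2 * (\<integral>\<^sup>+x. ennreal ((g x - h x)\<^sup>2) \<partial>M)"
    by (simp add: nn_integral_add nn_integral_cmult)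
  also have "\<dots> \<le> 2 * ennreal a + 2 * ennreal b"
    by (intro add_mono mult_left_mono assms) auto
  also have "\<dots> = ennreal (2 * a + 2 * b)"
    using assms by (simp add: ennreal_plus ennreal_mult)
  finally show ?thesis .
qed

lemma abs_integral_mult_le:
  assumes [measurable]: "g \<in> borel_measurable M" "h \<in> borel_measurable M"
    and "(\<integral>\<^sup>+x. ennreal ((g x)\<^sup>2) \<partial>M) \<le> ennreal a" "(\<integral>\<^sup>+x. ennreal ((h x)\<^sup>2) \<partial>M) \<le> ennreal b"
    and "0 \<le> a" "0 \<le> b"
  shows "\<bar>\<integral>x. g x * h x \<partial>M\<bar> \<le> sqrt (a * b)"
proof -
  have "(\<integral>\<^sup>+x. ennreal \<bar>g x\<bar> * ennreal \<bar>h x\<bar> \<partial>M)\<^sup>2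
      \<le> (\<integral>\<^sup>+x. (ennreal \<bar>g x\<bar>)\<^sup>2 \<partial>M) * (\<integral>\<^sup>+x. (ennreal \<bar>h x\<bar>)\<^sup>2 \<partial>M)"
    by (rule Cauchy_Schwarz_nn_integral) measurable
  also have "\<dots> \<le> ennreal a * ennreal b"
    using assms by (intro mult_mono) (auto simp: ennreal_power)
  also have "\<dots> = (ennreal (sqrt (a * b)))\<^sup>2"
    using assms by (simp add: ennreal_power flip: ennreal_mult)
  finally have "(\<integral>\<^sup>+x. ennreal \<bar>g x\<bar> * ennreal \<bar>h x\<bar> \<partial>M) \<le> ennreal (sqrt (a * b))"
    using assms by (intro ennreal_le_of_square_le) auto
  then have "(\<integral>\<^sup>+x. ennreal (norm (g x * h x)) \<partial>M) \<le> ennreal (sqrt (a * b))"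
    by (simp add: abs_mult ennreal_mult)
  moreover have "ennreal (norm (\<integral>x. g x * h x \<partial>M)) \<le> (\<integral>\<^sup>+x. ennreal (norm (g x * h x)) \<partial>M)"
    by (cases "integrable M (\<lambda>x. g x * h x)")
       (simp_all add: integral_norm_bound_ennreal not_integrable_integral_eq del: real_norm_def)
  ultimately have "ennreal \<bar>\<integral>x. g x * h x \<partial>M\<bar> \<le> ennreal (sqrt (a * b))"
    by (metis order.trans real_norm_def)
  then show ?thesis using assms by simp
qed

lemma truncate_coeff_support: "truncate_coeff N m a i \<noteq> 0 \<Longrightarrow> p < N \<Longrightarrow> i p < m"
  by (auto simp: truncate_coeff_def split: if_splits)

lemma step_function_diff:
  "step_function N n x a u - step_function N n x b u = step_function N n x (\<lambda>i. a i - b i) u"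
  by (simp add: step_function_def sum_subtractf left_diff_distrib)

lemma step_integral_diff:
  "step_integral B N n x a \<omega> - step_integral B N n x b \<omega> = step_integral B N n x (\<lambda>i. a i - b i) \<omega>"
  by (simp add: step_integral_def sum_subtractf left_diff_distrib)

context brownian_motion
begin

lemmas measurable_B' [measurable] = measurable_B

lemma measurable_step_integral [measurable]: "step_integral B N n x a \<in> borel_measurable M"
  unfolding step_integral_def by measurable

text \<open>
  Restricted to \<open>{..<n}\<close>, so that its values are points of the product space.
\<close>

definition grid_increments :: "(nat \<Rightarrow> real) \<Rightarrow> nat \<Rightarrow> 'w \<Rightarrow> nat \<Rightarrow> real" where
  "grid_increments x n \<omega> = (\<lambda>j\<in>{..<n}. B (x (Suc j)) \<omega> - B (x j) \<omega>)"

lemma distr_grid_increments: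
  assumes x: "strict_mono_on {..n} x" and v: "\<And>j. j < n \<Longrightarrow> v j = x (Suc j) - x j"
  shows "distr M (\<Pi>\<^sub>M j\<in>{..<n}. gauss (v j)) (grid_increments x n) = (\<Pi>\<^sub>M j\<in>{..<n}. gauss (v j))"
proof (cases "n = 0")
  case True
  \<comment> \<open>With no cells, both sides are the point mass at the function without arguments.\<close>
  have "distr M (\<Pi>\<^sub>M j\<in>{..<n}. gauss (v j)) (grid_increments x n) = distr M (count_space {\<lambda>k. undefined}) (\<lambda>_ k. undefined)"
    unfolding grid_increments_def using True by (simp add: PiM_empty restrict_def)
  also have "\<dots> = count_space {\<lambda>k. undefined}"
  proof (rule measure_eqI)
    fix A assume "A \<in> sets (distr M (count_space {\<lambda>k. undefined :: real}) (\<lambda>_ k :: nat. undefined))"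
    then have "A = {} \<or> A = {\<lambda>k. undefined}" by auto
    then show "emeasure (distr M (count_space {\<lambda>k. undefined :: real}) (\<lambda>_ k :: nat. undefined)) A
        = emeasure (count_space {\<lambda>k. undefined}) A"
      by (auto simp: emeasure_distr emeasure_space_1)
  qed simp
  finally show ?thesis using True by (simp add: PiM_empty)
next
  case False
  have "distr M (\<Pi>\<^sub>M j\<in>{..<n}. gauss (v j)) (grid_increments x n)
      = distr M (\<Pi>\<^sub>M j\<in>{..<n}. borel) (\<lambda>\<omega>. \<lambda>j\<in>{..<n}. B (x (Suc j)) \<omega> - B (x j) \<omega>)"
    unfolding grid_increments_def by (intro distr_cong sets_PiM_cong) auto
  also have "\<dots> = (\<Pi>\<^sub>M j\<in>{..<n}. distr M borel (\<lambda>\<omega>. B (x (Suc j)) \<omega> - B (x j) \<omega>))"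
    using indep_increments[OF x] False by (subst (asm) indep_vars_iff_distr_eq_PiM) auto
  also have "\<dots> = (\<Pi>\<^sub>M j\<in>{..<n}. gauss (v j))"
  proof (intro PiM_cong refl)
    fix j assume "j \<in> {..<n}"
    then have "x j < x (Suc j)" using strict_mono_onD[OF x, of j "Suc j"] by auto
    then have "distr M lborel (\<lambda>\<omega>. B (x (Suc j)) \<omega> - B (x j) \<omega>) = gauss (v j)"
      using normal_increments[of "x j" "x (Suc j)"] v[of j] \<open>j \<in> _\<close> by (simp add: distributed_def gauss_def)
    moreover have "distr M lborel (\<lambda>\<omega>. B (x (Suc j)) \<omega> - B (x j) \<omega>) = distr M borel (\<lambda>\<omega>. B (x (Suc j)) \<omega> - B (x j) \<omega>)"
      by (intro distr_cong) auto
    ultimately show "distr M borel (\<lambda>\<omega>. B (x (Suc j)) \<omega> - B (x j) \<omega>) = gauss (v j)" by simp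
  qed
  finally show ?thesis .
qed

lemma measurable_grid_increments [measurable]:
  "grid_increments x n \<in> measurable M (\<Pi>\<^sub>M j\<in>{..<n}. gauss (v j))"
  unfolding grid_increments_def by (intro measurable_restrict) simp

lemma step_integral_eq_grid_increments:
  "step_integral B N n x a \<omega> = multilinear (coeff_sum N n a) {..<n} (grid_increments x n \<omega>)"
  unfolding step_integral_eq_multilinear grid_increments_def by (intro multilinear_cong) auto

text \<open>
  Continuity of the integral on step functions, with the constant \<open>N ^ N\<close>. It is used to carry a
  truncation of the integrands over to the integrals.
\<close>

lemma step_integral_norm_le:
  assumes x: "strict_mono_on {..n} x"
  shows "(\<integral>\<^sup>+\<omega>. ennreal ((step_integral B N n x a \<omega>)\<^sup>2) \<partial>M)
    \<le> ennreal (real N ^ N) * (\<integral>\<^sup>+u. ennreal ((step_function N n x a u)\<^sup>2) \<partial>lebesgue_power N)"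
proof -
  define v where "v j = (if j < n then x (Suc j) - x j else 1)" for j
  have "gaussian_product v"
    by standard (use strict_mono_onD[OF x] in \<open>auto simp: v_def\<close>)
  then interpret gaussian_product v .
  have "(\<integral>\<^sup>+\<omega>. ennreal ((step_integral B N n x a \<omega>)\<^sup>2) \<partial>M)
      = (\<integral>\<^sup>+y. ennreal ((multilinear (coeff_sum N n a) {..<n} y)\<^sup>2) \<partial>distr M (P {..<n}) (grid_increments x n))"
    unfolding step_integral_eq_grid_increments by (subst nn_integral_distr) auto
  also have "\<dots> = ennreal (\<Sum>A\<in>Pow {..<n}. (coeff_sum N n a A)\<^sup>2 * prod v A)"
    by (subst distr_grid_increments[OF x]) (simp_all add: v_def[abs_def] multilinear_second_moment[unfolded v_def])
  also have "\<dots> \<le> ennreal (real N ^ N * (\<Sum>i\<in>offdiag_indices N n. (a i)\<^sup>2 * (\<Prod>p<N. v (i p))))"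
    by (intro ennreal_leI sum_coeff_sum_square_le less_imp_le v_pos)
  also have "(\<Sum>i\<in>offdiag_indices N n. (a i)\<^sup>2 * (\<Prod>p<N. v (i p)))
      = (\<Sum>i\<in>offdiag_indices N n. (a i)\<^sup>2 * (\<Prod>p<N. x (Suc (i p)) - x (i p)))"
    by (intro sum.cong refl arg_cong2[where f = "(*)"] prod.cong) (auto simp: v_def dest: offdiag_indices_less)
  finally show ?thesis
    by (simp add: ennreal_mult' step_function_norm[OF x])
qed

text \<open>
  The integrals of finitely many integrands come with unrelated grids. Passing to the union of all
  grid points turns their approximations into polynomials in one family of Gaussian variables.
\<close>

lemma wiener_common_grid:
  assumes Y: "\<And>i. i \<le> L \<Longrightarrow> has_multiple_wiener_integral M B N (f i) (Y i)"
    and T: "finite T" "T \<noteq> {}" and "\<eta> > 0"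
  obtains n x a where "strict_mono_on {..n} x" "T \<subseteq> x ` {..n}"
    "\<And>i. i \<le> (L::nat) \<Longrightarrow> (\<integral>\<^sup>+u. ennreal ((f i u - step_function N n x (a i) u)\<^sup>2) \<partial>lebesgue_power N) < \<eta>"
    "\<And>i. i \<le> L \<Longrightarrow> (\<integral>\<^sup>+\<omega>. ennreal ((Y i \<omega> - step_integral B N n x (a i) \<omega>)\<^sup>2) \<partial>M) < \<eta>"
proof -
  define Q where "Q i n x a \<longleftrightarrow> strict_mono_on {..n} x \<and>
      (\<integral>\<^sup>+u. ennreal ((f i u - step_function N n x a u)\<^sup>2) \<partial>lebesgue_power N) < \<eta> \<and>
      (\<integral>\<^sup>+\<omega>. ennreal ((Y i \<omega> - step_integral B N n x a \<omega>)\<^sup>2) \<partial>M) < \<eta>" for i n x a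
  have "\<exists>n x a. Q i n x a" if i: "i \<le> L" for i
  proof -
    obtain n x a where *: "\<And>k. strict_mono_on {..n k} (x k)"
      "(\<lambda>k. \<integral>\<^sup>+u. ennreal ((f i u - step_function N (n k) (x k) (a k) u)\<^sup>2) \<partial>lebesgue_power N) \<longlonglongrightarrow> 0"
      "(\<lambda>k. \<integral>\<^sup>+\<omega>. ennreal ((Y i \<omega> - step_integral B N (n k) (x k) (a k) \<omega>)\<^sup>2) \<partial>M) \<longlonglongrightarrow> 0"
      using Y[OF i] unfolding has_multiple_wiener_integral_def by auto
    have "eventually (\<lambda>k. (\<integral>\<^sup>+u. ennreal ((f i u - step_function N (n k) (x k) (a k) u)\<^sup>2) \<partial>lebesgue_power N) < \<eta>
        \<and> (\<integral>\<^sup>+\<omega>. ennreal ((Y i \<omega> - step_integral B N (n k) (x k) (a k) \<omega>)\<^sup>2) \<partial>M) < \<eta>) sequentially"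
      using *(2,3) \<open>\<eta> > 0\<close> by (intro eventually_conj order_tendstoD(2))
    then obtain k where
      "(\<integral>\<^sup>+u. ennreal ((f i u - step_function N (n k) (x k) (a k) u)\<^sup>2) \<partial>lebesgue_power N) < \<eta>"
      "(\<integral>\<^sup>+\<omega>. ennreal ((Y i \<omega> - step_integral B N (n k) (x k) (a k) \<omega>)\<^sup>2) \<partial>M) < \<eta>"
      by (auto simp: eventually_sequentially)
    then show ?thesis
      using *(1)[of k] unfolding Q_def by blast
  qed
  then obtain n x a where Q: "\<And>i. i \<le> L \<Longrightarrow> Q i (n i) (x i) (a i)"
    by metis
  note * = Q[unfolded Q_def, THEN conjunct1] Q[unfolded Q_def, THEN conjunct2, THEN conjunct1]
    Q[unfolded Q_def, THEN conjunct2, THEN conjunct2]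
  define T' where "T' = T \<union> (\<Union>i\<le>L. x i ` {..n i})"
  obtain n' :: nat and x' where x': "strict_mono_on {..n'} x'" "x' ` {..n'} = T'"
    using finite_set_as_grid[of T'] T by (auto simp: T'_def)
  define R where "R i a' \<longleftrightarrow> (\<forall>u. step_function N n' x' a' u = step_function N (n i) (x i) (a i) u) \<and>
      (\<forall>\<omega>. step_integral B N n' x' a' \<omega> = step_integral B N (n i) (x i) (a i) \<omega>)" for i a'
  have "\<exists>a'. R i a'" if i: "i \<le> L" for i
  proof -
    have sub: "x i ` {..n i} \<subseteq> x' ` {..n'}" using that x'(2) by (auto simp: T'_def)
    show ?thesis
      using step_function_refine[OF *(1)[OF i] x'(1) sub, where N = N and a = "a i" and 'w = 'w]
      unfolding R_def by blast
  qed
  then obtain a' where R: "\<And>i. i \<le> L \<Longrightarrow> R i (a' i)"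
    by metis
  note a' = R[unfolded R_def, THEN conjunct1, rule_format] R[unfolded R_def, THEN conjunct2, rule_format]
  show thesis
  proof (rule that[of n' x' a'])
    show "strict_mono_on {..n'} x'" "T \<subseteq> x' ` {..n'}"
      using x' by (auto simp: T'_def)
    fix i assume i: "i \<le> L"
    show "(\<integral>\<^sup>+u. ennreal ((f i u - step_function N n' x' (a' i) u)\<^sup>2) \<partial>lebesgue_power N) < \<eta>"
      unfolding a'(1)[OF i] by (rule *(2)[OF i])
    show "(\<integral>\<^sup>+\<omega>. ennreal ((Y i \<omega> - step_integral B N n' x' (a' i) \<omega>)\<^sup>2) \<partial>M) < \<eta>"
      unfolding a'(2)[OF i] by (rule *(3)[OF i])
  qed
qed

text \<open>
  If an integrand vanishes when some coordinate exceeds \<open>t i\<close>, its approximating step function may be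
  truncated at \<open>t i\<close>: the truncation does not increase the error for the integrand, and it changes
  the step function by no more than that error. By the norm bound, the step integral changes
  little as well. The approximating integrals are thereby adapted to the past of \<open>t i\<close>.
\<close>

lemma wiener_adapted_approximation:
  assumes Y: "\<And>i. i \<le> L \<Longrightarrow> has_multiple_wiener_integral M B N (f i) (Y i)"
    and supp: "\<And>i u p. i \<le> (L::nat) \<Longrightarrow> p < N \<Longrightarrow> u p > t i \<Longrightarrow> f i u = 0"
    and "\<eta> > (0::real)"
  obtains n x m a where "strict_mono_on {..n} x" "\<And>i. i \<le> L \<Longrightarrow> m i \<le> n" "\<And>i. i \<le> L \<Longrightarrow> x (m i) = t i"
    "\<And>i k p. i \<le> L \<Longrightarrow> a i k \<noteq> 0 \<Longrightarrow> p < N \<Longrightarrow> k p < m i"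
    "\<And>i. i \<le> L \<Longrightarrow> (\<integral>\<^sup>+u. ennreal ((f i u - step_function N n x (a i) u)\<^sup>2) \<partial>lebesgue_power N) \<le> ennreal \<eta>"
    "\<And>i. i \<le> L \<Longrightarrow> (\<integral>\<^sup>+\<omega>. ennreal ((Y i \<omega> - step_integral B N n x (a i) \<omega>)\<^sup>2) \<partial>M) \<le> ennreal \<eta>"
proof -
  \<comment> \<open>The constant in the final error: truncating costs a factor \<open>N ^ N\<close>, and the square of a sum of
    two errors is at most twice the sum of their squares.\<close>
  define \<theta> where "\<theta> = \<eta> / (2 + 2 * real N ^ N)"
  have "\<theta> > 0" using \<open>\<eta> > 0\<close> by (simp add: \<theta>_def add_pos_nonneg)
  have "\<theta> * (2 + 2 * real N ^ N) = \<eta>"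
    using add_pos_nonneg[of 2 "2 * real N ^ N"] by (simp add: \<theta>_def)
  then have \<eta>: "2 * \<theta> + 2 * (real N ^ N * \<theta>) = \<eta>" by (simp add: algebra_simps)
  moreover have "0 \<le> real N ^ N * \<theta>" using \<open>\<theta> > 0\<close> by simp
  ultimately have "\<theta> \<le> \<eta>" using \<open>\<theta> > 0\<close> by linarith
  obtain n x a where *: "strict_mono_on {..n} x" "t ` {..L} \<subseteq> x ` {..n}"
    "\<And>i. i \<le> L \<Longrightarrow> (\<integral>\<^sup>+u. ennreal ((f i u - step_function N n x (a i) u)\<^sup>2) \<partial>lebesgue_power N) < ennreal \<theta>"
    "\<And>i. i \<le> L \<Longrightarrow> (\<integral>\<^sup>+\<omega>. ennreal ((Y i \<omega> - step_integral B N n x (a i) \<omega>)\<^sup>2) \<partial>M) < ennreal \<theta>"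
    using \<open>\<theta> > 0\<close>
    by (rule_tac wiener_common_grid[where f = f and Y = Y and L = L and N = N and T = "t ` {..L}" and \<eta> = "ennreal \<theta>", OF Y])
       auto
  have "\<forall>i\<in>{..L}. \<exists>m\<in>{..n}. x m = t i" using *(2) by (force simp: image_subset_iff)
  then obtain m where m: "\<And>i. i \<le> L \<Longrightarrow> m i \<le> n" "\<And>i. i \<le> L \<Longrightarrow> x (m i) = t i"
    by (metis atMost_iff)
  define b where "b i = truncate_coeff N (m i) (a i)" for i
  have b: "step_function N n x (b i) u = (if \<forall>p<N. u p \<le> t i then step_function N n x (a i) u else 0)"
    if "i \<le> L" for i u
    unfolding b_def using step_function_truncate[OF *(1) m(1)[OF that], of N "a i" u] m(2)[OF that] by simp
  have zero: "f i u = 0" if "i \<le> L" "\<not> (\<forall>p<N. u p \<le> t i)" for i u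
    using supp that by (auto simp: not_le)
  show thesis
  proof (rule that[of n x m b])
    fix i assume i: "i \<le> L"
    have "(\<integral>\<^sup>+u. ennreal ((f i u - step_function N n x (b i) u)\<^sup>2) \<partial>lebesgue_power N)
        \<le> (\<integral>\<^sup>+u. ennreal ((f i u - step_function N n x (a i) u)\<^sup>2) \<partial>lebesgue_power N)"
      using zero[OF i] by (intro nn_integral_mono ennreal_leI) (simp add: b[OF i])
    then show "(\<integral>\<^sup>+u. ennreal ((f i u - step_function N n x (b i) u)\<^sup>2) \<partial>lebesgue_power N) \<le> ennreal \<eta>"
      using *(3)[OF i] ennreal_leI[OF \<open>\<theta> \<le> \<eta>\<close>] by (meson less_imp_le order.trans)
    have [measurable]: "Y i \<in> borel_measurable M"
      using Y[OF i] by (auto simp: has_multiple_wiener_integral_def)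
    have "(\<integral>\<^sup>+u. ennreal ((step_function N n x (\<lambda>k. a i k - b i k) u)\<^sup>2) \<partial>lebesgue_power N)
        \<le> (\<integral>\<^sup>+u. ennreal ((f i u - step_function N n x (a i) u)\<^sup>2) \<partial>lebesgue_power N)"
      unfolding step_function_diff[symmetric]
      using zero[OF i] by (intro nn_integral_mono ennreal_leI) (simp add: b[OF i])
    also have "\<dots> \<le> ennreal \<theta>"
      using *(3)[OF i] by simp
    finally have "(\<integral>\<^sup>+\<omega>. ennreal ((step_integral B N n x (a i) \<omega> - step_integral B N n x (b i) \<omega>)\<^sup>2) \<partial>M)
        \<le> ennreal (real N ^ N) * ennreal \<theta>"
      unfolding step_integral_diff by (intro order.trans[OF step_integral_norm_le[OF *(1)]] mult_left_mono) auto
    then have "(\<integral>\<^sup>+\<omega>. ennreal ((Y i \<omega> - step_integral B N n x (b i) \<omega>)\<^sup>2) \<partial>M)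
        \<le> ennreal (2 * \<theta> + 2 * (real N ^ N * \<theta>))"
      using *(4)[OF i] \<open>\<theta> > 0\<close>
      by (intro nn_integral_square_diff_le[where g = "step_integral B N n x (a i)"])
         (auto simp: ennreal_mult)
    then show "(\<integral>\<^sup>+\<omega>. ennreal ((Y i \<omega> - step_integral B N n x (b i) \<omega>)\<^sup>2) \<partial>M) \<le> ennreal \<eta>"
      by (simp add: \<eta>)
  qed (use * m in \<open>auto simp: b_def dest: truncate_coeff_support\<close>)
qed

end

section \<open>The probability that all increments are small\<close>

context brownian_motion
begin

text \<open>
  Approximate \<open>Y i\<close> by adapted step integrals on a common grid and apply the chain of conditional
  small ball estimates to their differences. The conditional variance of the \<open>i\<close>-th increment is
  bounded from below by the terms in which all \<open>N\<close> Brownian increments come from the new interval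
  \<open>{t i<..t (Suc i)}\<close>. By Cauchy--Schwarz against the indicator of the cube over this interval, of
  volume \<open>\<delta> ^ N\<close>, it is at least \<open>\<beta>\<^sup>2 / \<delta> ^ N\<close>, up to the loss from the approximation. The limit
  is taken at the level of probabilities, through Markov's inequality.
\<close>

lemma small_increments_probability:
  assumes Y: "\<And>i. i \<le> L \<Longrightarrow> has_multiple_wiener_integral M B N (f i) (Y i)"
    and supp: "\<And>i u p. i \<le> (L::nat) \<Longrightarrow> p < N \<Longrightarrow> u p > t i \<Longrightarrow> f i u = 0"
    and t: "\<And>i. i < L \<Longrightarrow> t (Suc i) = t i + \<delta>" and "\<delta> > 0" and "N \<ge> 1"
    and int: "\<And>i. i < L \<Longrightarrow> integrable (lebesgue_power N) (\<lambda>u. f (Suc i) u * (\<Prod>p<N. indicator {t i<..t (Suc i)} (u p)))"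
    and low: "\<And>i. i < L \<Longrightarrow> \<beta> \<le> (\<integral>u. f (Suc i) u * (\<Prod>p<N. indicator {t i<..t (Suc i)} (u p)) \<partial>lebesgue_power N)"
    and \<sigma>: "\<sigma> > 0" "\<sigma>\<^sup>2 * \<delta> ^ N \<le> (\<beta> / 2)\<^sup>2" and "\<beta> > 0"
  shows "emeasure M {\<omega> \<in> space M. \<forall>i<L. \<bar>Y (Suc i) \<omega> - Y i \<omega>\<bar> \<le> \<sigma> / 4}
    \<le> ennreal ((1 - 1 / (2 * 9 ^ N)) ^ L)"
proof (rule ennreal_le_epsilon)
  define q where "q = (1 - 1 / (2 * 9 ^ N) :: real)"
  fix e :: real assume "e > 0"
  \<comment> \<open>The first bound keeps the total error probability below \<open>e\<close>, the second loses at most half of \<open>\<beta>\<close>.\<close>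
  define \<eta> where "\<eta> = min (e * (\<sigma> / 4)\<^sup>2 / (4 * (real L + 1))) ((\<beta> / 2)\<^sup>2 / \<delta> ^ N)"
  have \<eta>: "\<eta> > 0" "real L * (4 * \<eta> / (\<sigma> / 4)\<^sup>2) \<le> e" "\<eta> * \<delta> ^ N \<le> (\<beta> / 2)\<^sup>2"
  proof -
    show "\<eta> > 0" using \<open>e > 0\<close> \<open>\<sigma> > 0\<close> \<open>\<beta> > 0\<close> \<open>\<delta> > 0\<close> by (simp add: \<eta>_def)
    have "\<eta> \<le> e * (\<sigma> / 4)\<^sup>2 / (4 * (real L + 1))" by (simp add: \<eta>_def)
    then have "4 * \<eta> / (\<sigma> / 4)\<^sup>2 * (real L + 1) \<le> e"
      using \<open>\<sigma> > 0\<close> by (simp add: field_simps)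
    moreover have "0 \<le> 4 * \<eta> / (\<sigma> / 4)\<^sup>2" using \<open>\<eta> > 0\<close> by simp
    ultimately show "real L * (4 * \<eta> / (\<sigma> / 4)\<^sup>2) \<le> e"
      by (simp only: distrib_left mult_1_right mult.commute[of "real L"])
    have "\<eta> \<le> (\<beta> / 2)\<^sup>2 / \<delta> ^ N" by (simp add: \<eta>_def)
    then show "\<eta> * \<delta> ^ N \<le> (\<beta> / 2)\<^sup>2" using \<open>\<delta> > 0\<close> by (simp add: pos_le_divide_eq)
  qed
  obtain n x m a where x: "strict_mono_on {..n} x" and m: "\<And>i. i \<le> L \<Longrightarrow> m i \<le> n" "\<And>i. i \<le> L \<Longrightarrow> x (m i) = t i"
    and a: "\<And>i k p. i \<le> L \<Longrightarrow> a i k \<noteq> 0 \<Longrightarrow> p < N \<Longrightarrow> k p < m i"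
    and errf: "\<And>i. i \<le> L \<Longrightarrow> (\<integral>\<^sup>+u. ennreal ((f i u - step_function N n x (a i) u)\<^sup>2) \<partial>lebesgue_power N) \<le> ennreal \<eta>"
    and errY: "\<And>i. i \<le> L \<Longrightarrow> (\<integral>\<^sup>+\<omega>. ennreal ((Y i \<omega> - step_integral B N n x (a i) \<omega>)\<^sup>2) \<partial>M) \<le> ennreal \<eta>"
    using wiener_adapted_approximation[where L = L and N = N and f = f and Y = Y and t = t and \<eta> = \<eta>]
      Y supp \<eta>(1) by blast
  define v where "v j = (if j < n then x (Suc j) - x j else 1)" for j
  have "gaussian_product v"
    by standard (use strict_mono_onD[OF x] in \<open>auto simp: v_def\<close>)
  then interpret gaussian_product v .
  have m_less: "m i < m (Suc i)" if "i < L" for i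
  proof (rule ccontr)
    assume "\<not> m i < m (Suc i)"
    then have "x (m (Suc i)) \<le> x (m i)"
      using m(1)[of i] that by (intro strict_mono_on_atMost_le[OF x]) auto
    then show False using m(2) t[OF that] that \<open>\<delta> > 0\<close> by simp
  qed
  define c where "c i A = coeff_sum N n (a (Suc i)) A - coeff_sum N n (a i) A" for i A
  have coeff: "card A = N \<and> A \<subseteq> {..<m i}" if i: "i \<le> L" and A: "coeff_sum N n (a i) A \<noteq> 0" for i A
  proof -
    obtain k where "a i k \<noteq> 0" "k ` {..<N} = A"
      using coeff_sum_support(2)[OF A] by auto
    then show ?thesis
      using a[OF i, of k] coeff_sum_support(1)[OF A] by blast
  qed
  have var: "\<sigma>\<^sup>2 \<le> (\<Sum>A | A \<subseteq> {..<m (Suc i)} - {..<m i} \<and> card A = N. (c i A)\<^sup>2 * prod v A)"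
    if i: "i < L" for i
  proof -
    define J where "J = {m i..<m (Suc i)}"
    define D where "D = {A. A \<subseteq> J \<and> card A = N}"
    have J: "J \<subseteq> {..<n}" using m(1)[of "Suc i"] i by (auto simp: J_def)
    have [simp]: "finite J" "finite D" unfolding J_def D_def by (auto intro: finite_subset[of _ "Pow {m i..<m (Suc i)}"])
    define C where "C u = (\<Prod>p<N. indicator {x (m i)<..x (m (Suc i))} (u p) :: real)" for u
    have C_eq: "C = (\<lambda>u. \<Prod>p<N. indicator {t i<..t (Suc i)} (u p))"
      using m(2) i by (simp add: C_def[abs_def])
    define s where "s = (\<Sum>A\<in>Pow J. coeff_sum N n (a (Suc i)) A * (\<Prod>j\<in>A. x (Suc j) - x j))"
    have step: "has_bochner_integral (lebesgue_power N) (\<lambda>u. step_function N n x (a (Suc i)) u * C u) s"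
      unfolding C_def s_def J_def using m(1) m_less[OF i] i by (intro step_function_box_integral[OF x]) auto
    have C_sq: "C u ^ 2 = C u" for u
      unfolding C_def prod_power_distrib by (intro prod.cong) (auto simp: indicator_def)
    have C_int: "(\<integral>\<^sup>+u. ennreal ((C u)\<^sup>2) \<partial>lebesgue_power N) = ennreal (\<delta> ^ N)"
    proof -
      have le: "t i \<le> t (Suc i)" using t[OF i] \<open>\<delta> > 0\<close> by simp
      have "integrable (lebesgue_power N) C" "(\<integral>u. C u \<partial>lebesgue_power N) = \<delta> ^ N"
        unfolding C_eq using box_indicator_integral[of N "\<lambda>_. t i" "\<lambda>_. t (Suc i)", OF le]
        by (simp_all add: t[OF i])
      moreover have "C u \<ge> 0" for u unfolding C_def by (intro prod_nonneg) auto
      ultimately show ?thesis unfolding C_sq by (subst nn_integral_eq_integral) auto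
    qed
    have meas [measurable]: "f (Suc i) \<in> borel_measurable (lebesgue_power N)"
      using Y[of "Suc i"] i by (auto simp: has_multiple_wiener_integral_def)
    have [measurable]: "C \<in> borel_measurable (lebesgue_power N)"
      unfolding C_def by measurable
    have "(\<integral>u. f (Suc i) u * C u \<partial>lebesgue_power N) - s
        = (\<integral>u. f (Suc i) u * C u - step_function N n x (a (Suc i)) u * C u \<partial>lebesgue_power N)"
      using int[OF i, folded C_eq] step by (subst Bochner_Integration.integral_diff) (auto simp: has_bochner_integral_iff C_eq)
    also have "\<dots> = (\<integral>u. (f (Suc i) u - step_function N n x (a (Suc i)) u) * C u \<partial>lebesgue_power N)"
      by (simp add: left_diff_distrib)
    also have "\<dots> \<le> sqrt (\<eta> * \<delta> ^ N)"
    proof (rule order.trans[OF abs_ge_self], rule abs_integral_mult_le)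
      show "(\<integral>\<^sup>+u. ennreal ((f (Suc i) u - step_function N n x (a (Suc i)) u)\<^sup>2) \<partial>lebesgue_power N) \<le> ennreal \<eta>"
        using errf[of "Suc i"] i by simp
      show "(\<integral>\<^sup>+u. ennreal ((C u)\<^sup>2) \<partial>lebesgue_power N) \<le> ennreal (\<delta> ^ N)"
        using C_int by simp
    qed (use \<eta> \<open>\<delta> > 0\<close> in auto)
    also have "\<dots> \<le> \<beta> / 2"
      using \<eta>(3) \<open>\<beta> > 0\<close> by (intro real_le_lsqrt) auto
    finally have "\<beta> / 2 \<le> s"
      using low[OF i] by (simp add: C_eq)
    then have "(\<beta> / 2)\<^sup>2 \<le> s\<^sup>2" using \<open>\<beta> > 0\<close> by (intro power_mono) auto
    \<comment> \<open>The approximation of \<open>Y i\<close> has no monomial in increments after \<open>t i\<close>.\<close>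
    have past: "coeff_sum N n (a i) A = 0" if A: "A \<subseteq> J" "card A = N" for A
    proof (rule ccontr)
      assume "coeff_sum N n (a i) A \<noteq> 0"
      then have "A \<subseteq> {..<m i}" using coeff[of i A] i by auto
      then have "A = {}" using A by (force simp: J_def)
      then show False using A \<open>N \<ge> 1\<close> by simp
    qed
    have "s = (\<Sum>A\<in>D. coeff_sum N n (a (Suc i)) A * (\<Prod>j\<in>A. x (Suc j) - x j))"
      unfolding s_def
      by (intro sum.mono_neutral_right) (auto simp: D_def dest: coeff_sum_support(1))
    also have "\<dots> = (\<Sum>A\<in>D. c i A * prod v A)"
    proof (intro sum.cong refl)
      fix A assume A: "A \<in> D"
      then have "(\<Prod>j\<in>A. x (Suc j) - x j) = prod v A"
        using J by (intro prod.cong) (auto simp: v_def D_def)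
      then show "coeff_sum N n (a (Suc i)) A * (\<Prod>j\<in>A. x (Suc j) - x j) = c i A * prod v A"
        using past[of A] A by (simp add: c_def D_def)
    qed
    finally have s: "s = (\<Sum>A\<in>D. c i A * prod v A)" .
    have v0: "prod v A \<ge> 0" for A by (intro prod_nonneg) (auto simp: v_pos less_imp_le)
    \<comment> \<open>Cauchy--Schwarz with weights \<open>prod v A\<close>, the discrete form of testing against the indicator of the cube.\<close>
    have "s\<^sup>2 = (\<Sum>A\<in>D. (c i A * sqrt (prod v A)) * sqrt (prod v A))\<^sup>2"
      unfolding s using v0 by (simp add: mult.assoc)
    also have "\<dots> \<le> (\<Sum>A\<in>D. (c i A * sqrt (prod v A))\<^sup>2) * (\<Sum>A\<in>D. (sqrt (prod v A))\<^sup>2)"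
      by (rule Cauchy_Schwarz_ineq_sum)
    also have "\<dots> = (\<Sum>A\<in>D. (c i A)\<^sup>2 * prod v A) * (\<Sum>A\<in>D. prod v A)"
      using v0 by (simp add: power_mult_distrib)
    also have "\<dots> \<le> (\<Sum>A\<in>D. (c i A)\<^sup>2 * prod v A) * \<delta> ^ N"
    proof (intro mult_left_mono sum_nonneg mult_nonneg_nonneg v0)
      have "sum v J = (\<Sum>j\<in>J. x (Suc j) - x j)"
        using J by (intro sum.cong) (auto simp: v_def)
      also have "\<dots> = x (m (Suc i)) - x (m i)"
        unfolding J_def using m_less[OF i] by (intro sum_Suc_diff') simp
      also have "\<dots> = \<delta>" using m(2) t[OF i] i by simp
      finally show "(\<Sum>A\<in>D. prod v A) \<le> \<delta> ^ N"
        using sum_subset_products_le[of J v N] v_pos by (simp add: D_def less_imp_le)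
    qed auto
    finally have "\<sigma>\<^sup>2 * \<delta> ^ N \<le> (\<Sum>A\<in>D. (c i A)\<^sup>2 * prod v A) * \<delta> ^ N"
      using \<sigma>(2) \<open>(\<beta> / 2)\<^sup>2 \<le> s\<^sup>2\<close> by linarith
    then have "\<sigma>\<^sup>2 \<le> (\<Sum>A\<in>D. (c i A)\<^sup>2 * prod v A)"
      using \<open>\<delta> > 0\<close> by simp
    moreover have "{..<m (Suc i)} - {..<m i} = J" by (auto simp: J_def)
    ultimately show ?thesis by (simp add: D_def)
  qed
  have m_mono: "m i \<le> m j" if "i \<le> j" "j \<le> L" for i j
    using that
  proof (induction j rule: dec_induct)
    case (step k)
    then show ?case using m_less[of k] by simp
  qed simp
  have c_support: "card A = N \<and> (A \<subseteq> {..<m i} \<or> A \<subseteq> {..<m (Suc i)})" if i: "i < L" and A: "c i A \<noteq> 0" for i A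
  proof (cases "coeff_sum N n (a i) A = 0")
    case True
    then have "coeff_sum N n (a (Suc i)) A \<noteq> 0" using A by (simp add: c_def)
    then show ?thesis using coeff[OF Suc_leI[OF i]] by simp
  next
    case False
    then show ?thesis using coeff[OF less_imp_le[OF i]] by simp
  qed
  \<comment> \<open>The chain lemma asks for an increasing sequence on all of \<open>\<nat>\<close>, hence the cut-off at \<open>L\<close>.\<close>
  define K where "K i = {..<m (min i L)}" for i
  have chain: "emeasure (P (K L)) {y \<in> space (P (K L)). \<forall>i<L. \<bar>multilinear (c i) (K L) y\<bar> \<le> \<sigma> / 2} \<le> ennreal (q ^ L)"
    unfolding q_def
  proof (rule multilinear_small_ball_chain)
    show "K i \<subseteq> K (Suc i)" for i
      unfolding K_def using m_mono[of "min i L" "min (Suc i) L"] by auto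
    show "card A = N \<and> A \<subseteq> K (Suc i)" if "i < L" "c i A \<noteq> 0" for i A
    proof -
      have sub: "{..<m i} \<subseteq> K (Suc i)" "{..<m (Suc i)} \<subseteq> K (Suc i)"
        using that(1) m_less[OF that(1)] by (auto simp: K_def min_def)
      then show ?thesis
        using c_support[OF that] by (meson order_trans)
    qed
    show "\<sigma>\<^sup>2 \<le> (\<Sum>A | A \<subseteq> K (Suc i) - K i \<and> card A = N. (c i A)\<^sup>2 * prod v A)" if "i < L" for i
      using var[OF that] that by (simp add: K_def min_def)
  qed (auto simp: K_def \<sigma>)
  define D where "D i \<omega> = step_integral B N n x (a (Suc i)) \<omega> - step_integral B N n x (a i) \<omega>" for i \<omega>
  have [measurable]: "D i \<in> borel_measurable M" for i
    unfolding D_def by measurable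
  have KL: "K L = {..<m L}" by (simp add: K_def)
  have x_m: "strict_mono_on {..m L} x"
    using x m(1)[of L] by (auto simp: strict_mono_on_def)
  have D_eq: "D i \<omega> = multilinear (c i) (K L) (grid_increments x (m L) \<omega>)" if "i < L" for i \<omega>
  proof -
    have "D i \<omega> = multilinear (c i) {..<n} (grid_increments x n \<omega>)"
      unfolding D_def step_integral_eq_grid_increments c_def multilinear_def
      by (simp add: sum_subtractf left_diff_distrib)
    also have "\<dots> = multilinear (c i) (K L) (grid_increments x n \<omega>)"
    proof (rule multilinear_support)
      show "A \<subseteq> K L" if "c i A \<noteq> 0" for A
      proof -
        have "{..<m i} \<subseteq> K L" "{..<m (Suc i)} \<subseteq> K L"
          using m_mono[of i L] m_mono[of "Suc i" L] \<open>i < L\<close> by (auto simp: KL)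
        then show ?thesis
          using c_support[OF \<open>i < L\<close> that] by (meson order_trans)
      qed
    qed (use m(1)[of L] in \<open>auto simp: KL\<close>)
    also have "\<dots> = multilinear (c i) (K L) (grid_increments x (m L) \<omega>)"
      using m(1)[of L] by (intro multilinear_cong) (auto simp: KL grid_increments_def)
    finally show ?thesis .
  qed
  define E where "E = {\<omega> \<in> space M. \<forall>i<L. \<bar>D i \<omega>\<bar> \<le> \<sigma> / 2}"
  have "emeasure M E = emeasure (distr M (P {..<m L}) (grid_increments x (m L)))
      {y \<in> space (P (K L)). \<forall>i<L. \<bar>multilinear (c i) (K L) y\<bar> \<le> \<sigma> / 2}"
  proof (subst emeasure_distr)
    show "emeasure M E = emeasure M (grid_increments x (m L) -`
        {y \<in> space (P (K L)). \<forall>i<L. \<bar>multilinear (c i) (K L) y\<bar> \<le> \<sigma> / 2} \<inter> space M)"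
    proof (rule arg_cong[where f = "emeasure M"])
      show "E = grid_increments x (m L) -`
        {y \<in> space (P (K L)). \<forall>i<L. \<bar>multilinear (c i) (K L) y\<bar> \<le> \<sigma> / 2} \<inter> space M"
        using measurable_space[OF measurable_grid_increments[of x "m L" v]]
        by (auto simp: E_def D_eq KL)
    qed
  qed (auto simp: KL)
  also have "distr M (P {..<m L}) (grid_increments x (m L)) = P (K L)"
    unfolding KL using m(1)[of L] by (intro distr_grid_increments[OF x_m]) (auto simp: v_def)
  finally have E: "emeasure M E \<le> ennreal (q ^ L)"
    using chain by simp
  define F where "F i = {\<omega> \<in> space M. \<sigma> / 4 \<le> \<bar>(Y (Suc i) \<omega> - Y i \<omega>) - D i \<omega>\<bar>}" for i
  have Y_meas [measurable]: "Y i \<in> borel_measurable M" if "i \<le> L" for i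
    using Y[OF that] by (auto simp: has_multiple_wiener_integral_def)
  have F: "F i \<in> sets M" "emeasure M (F i) \<le> ennreal (4 * \<eta> / (\<sigma> / 4)\<^sup>2)" if i: "i < L" for i
  proof -
    have [measurable]: "Y i \<in> borel_measurable M" "Y (Suc i) \<in> borel_measurable M"
      using i by auto
    show "F i \<in> sets M" unfolding F_def by measurable
    define G where "G \<omega> = (Y (Suc i) \<omega> - Y i \<omega>) - D i \<omega>" for \<omega>
    have [measurable]: "G \<in> borel_measurable M" unfolding G_def by measurable
    have "(\<integral>\<^sup>+\<omega>. ennreal (((Y (Suc i) \<omega> - step_integral B N n x (a (Suc i)) \<omega>) - (Y i \<omega> - step_integral B N n x (a i) \<omega>))\<^sup>2) \<partial>M)
        \<le> ennreal (2 * \<eta> + 2 * \<eta>)"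
      using errY[of i] errY[of "Suc i"] i \<eta>(1)
      by (intro nn_integral_square_diff_le[where g = "\<lambda>_. 0"])
         (auto simp: power2_commute[of "step_integral B N n x (a i) _"])
    then have G: "(\<integral>\<^sup>+\<omega>. ennreal ((G \<omega>)\<^sup>2) \<partial>M) \<le> ennreal (4 * \<eta>)"
      by (simp add: G_def D_def algebra_simps)
    have "1 \<le> 1 / (\<sigma> / 4)\<^sup>2 * r\<^sup>2" if "\<sigma> / 4 \<le> \<bar>r\<bar>" for r
      using power_mono[OF that, of 2] \<sigma> by (simp add: pos_le_divide_eq)
    then have "F i \<subseteq> {\<omega> \<in> space M. 1 \<le> ennreal (1 / (\<sigma> / 4)\<^sup>2) * ennreal ((G \<omega>)\<^sup>2)}"
      by (auto simp only: F_def G_def[symmetric] ennreal_mult[symmetric] ennreal_1[symmetric] zero_le_power2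
          zero_le_divide_1_iff mem_Collect_eq intro!: ennreal_leI)
    then have "emeasure M (F i) \<le> emeasure M {\<omega> \<in> space M. 1 \<le> ennreal (1 / (\<sigma> / 4)\<^sup>2) * ennreal ((G \<omega>)\<^sup>2)}"
      by (intro emeasure_mono) auto
    also have "\<dots> \<le> ennreal (1 / (\<sigma> / 4)\<^sup>2) * (\<integral>\<^sup>+\<omega>. ennreal ((G \<omega>)\<^sup>2) * indicator (space M) \<omega> \<partial>M)"
      using nn_integral_Markov_inequality[of "\<lambda>\<omega>. ennreal ((G \<omega>)\<^sup>2)" "space M" M "ennreal (1 / (\<sigma> / 4)\<^sup>2)"]
      by (simp add: Int_def)
    also have "(\<integral>\<^sup>+\<omega>. ennreal ((G \<omega>)\<^sup>2) * indicator (space M) \<omega> \<partial>M) = (\<integral>\<^sup>+\<omega>. ennreal ((G \<omega>)\<^sup>2) \<partial>M)"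
      by (intro nn_integral_cong) auto
    also have "ennreal (1 / (\<sigma> / 4)\<^sup>2) * \<dots> \<le> ennreal (1 / (\<sigma> / 4)\<^sup>2) * ennreal (4 * \<eta>)"
      by (intro mult_left_mono G) simp
    also have "\<dots> = ennreal (4 * \<eta> / (\<sigma> / 4)\<^sup>2)"
      using \<eta>(1) by (simp flip: ennreal_mult)
    finally show "emeasure M (F i) \<le> ennreal (4 * \<eta> / (\<sigma> / 4)\<^sup>2)" .
  qed
  have E_meas [measurable]: "E \<in> sets M" unfolding E_def by measurable
  have "{\<omega> \<in> space M. \<forall>i<L. \<bar>Y (Suc i) \<omega> - Y i \<omega>\<bar> \<le> \<sigma> / 4} \<subseteq> E \<union> (\<Union>i<L. F i)"
  proof
    fix \<omega> assume \<omega>: "\<omega> \<in> {\<omega> \<in> space M. \<forall>i<L. \<bar>Y (Suc i) \<omega> - Y i \<omega>\<bar> \<le> \<sigma> / 4}"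
    show "\<omega> \<in> E \<union> (\<Union>i<L. F i)"
    proof (cases "\<exists>i<L. \<omega> \<in> F i")
      case False
      have "\<bar>D i \<omega>\<bar> \<le> \<sigma> / 2" if "i < L" for i
      proof -
        have "\<bar>(Y (Suc i) \<omega> - Y i \<omega>) - D i \<omega>\<bar> < \<sigma> / 4"
          using False that \<omega> by (auto simp: F_def not_le)
        moreover have "\<bar>Y (Suc i) \<omega> - Y i \<omega>\<bar> \<le> \<sigma> / 4"
          using \<omega> that by blast
        ultimately show ?thesis by linarith
      qed
      then show ?thesis using \<omega> by (auto simp: E_def)
    qed auto
  qed
  then have "emeasure M {\<omega> \<in> space M. \<forall>i<L. \<bar>Y (Suc i) \<omega> - Y i \<omega>\<bar> \<le> \<sigma> / 4} \<le> emeasure M (E \<union> (\<Union>i<L. F i))"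
    using F by (intro emeasure_mono) auto
  also have "\<dots> \<le> emeasure M E + emeasure M (\<Union>i<L. F i)"
    using F by (intro emeasure_subadditive) auto
  also have "\<dots> \<le> emeasure M E + (\<Sum>i<L. emeasure M (F i))"
    using F by (intro add_left_mono emeasure_subadditive_finite) auto
  also have "\<dots> \<le> ennreal (q ^ L) + (\<Sum>i<L. ennreal (4 * \<eta> / (\<sigma> / 4)\<^sup>2))"
    using F E by (intro add_mono sum_mono) auto
  also have "(\<Sum>i<L. ennreal (4 * \<eta> / (\<sigma> / 4)\<^sup>2)) = ennreal (real L * (4 * \<eta> / (\<sigma> / 4)\<^sup>2))"
    using \<eta>(1) by (subst sum_ennreal) auto
  also have "\<dots> \<le> ennreal e"
    using \<eta>(2) by (rule ennreal_leI)
  finally show "emeasure M {\<omega> \<in> space M. \<forall>i<L. \<bar>Y (Suc i) \<omega> - Y i \<omega>\<bar> \<le> \<sigma> / 4}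
      \<le> ennreal ((1 - 1 / (2 * 9 ^ N)) ^ L) + ennreal e"
    by (simp add: q_def add_left_mono)
qed

end

section \<open>The kernel of the Hermite process\<close>

lemma borel_measurable_pos_powr [measurable]: "(\<lambda>y. pos_powr y a) \<in> borel_measurable borel"
  unfolding pos_powr_def by measurable

lemma pos_powr_nonneg: "pos_powr y a \<ge> 0"
  by (simp add: pos_powr_def)

lemma nn_integral_pos_powr:
  assumes "a > -1" "t \<le> s" "s \<le> T"
  shows "(\<integral>\<^sup>+x. ennreal (pos_powr (s - x) a * indicator {t<..T} x) \<partial>lborel)
    = ennreal ((s - t) powr (a + 1) / (a + 1))"
proof -
  have "(\<integral>\<^sup>+x. ennreal (pos_powr (s - x) a * indicator {t<..T} x) \<partial>lborel)
      = (\<integral>\<^sup>+y. ennreal (pos_powr (s - (s + (-1) * y)) a * indicator {t<..T} (s + (-1) * y)) \<partial>lborel)"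
    by (subst nn_integral_real_affine[where c = "-1" and t = s]) auto
  also have "\<dots> = (\<integral>\<^sup>+y. ennreal (indicator {0..s - t} y * y powr a) \<partial>lborel)"
  proof (rule nn_integral_cong_AE)
    \<comment> \<open>The end point \<open>x = t\<close>, which the half-open interval excludes.\<close>
    have "AE y in lborel. y \<noteq> s - t" by (rule AE_lborel_singleton)
    then show "AE y in lborel. ennreal (pos_powr (s - (s + (-1) * y)) a * indicator {t<..T} (s + (-1) * y))
        = ennreal (indicator {0..s - t} y * y powr a)"
      by eventually_elim (use assms in \<open>auto simp: pos_powr_def indicator_def\<close>)
  qed
  also have "\<dots> = ennreal ((s - t) powr (a + 1) / (a + 1))"
    using assms by (intro nn_integral_has_integral_lebesgue has_integral_powr_from_0) auto
  finally show ?thesis .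
qed

lemma nn_integral_pos_powr_before:
  assumes "s \<le> t"
  shows "(\<integral>\<^sup>+x. ennreal (pos_powr (s - x) a * indicator {t<..T} x) \<partial>lborel) = 0"
proof -
  have "pos_powr (s - x) a * indicator {t<..T} x = (0::real)" for x
    using assms by (auto simp: pos_powr_def indicator_def)
  then show ?thesis by (simp only: ennreal_0 nn_integral_const mult_zero_left)
qed

lemma hermite_kernel_eq_0:
  assumes "p < N" "u p \<ge> t"
  shows "hermite_kernel N H t u = 0"
proof -
  have "indicator {0..t} s *\<^sub>R (\<Prod>p<N. pos_powr (s - u p) (H - 3/2)) = (0::real)" for s
  proof (cases "s \<le> t")
    case True
    then have "(\<Prod>p<N. pos_powr (s - u p) (H - 3/2)) = 0"
      using assms by (intro prod_zero bexI[of _ p]) (auto simp: pos_powr_def)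
    then show ?thesis by simp
  qed simp
  then show ?thesis
    unfolding hermite_kernel_def set_lebesgue_integral_def by (simp only: integral_zero)
qed

text \<open>
  Exchange the integrals over \<open>u\<close> and \<open>s\<close>. For fixed \<open>s\<close> the integrand is a product of functions of one
  coordinate, each with integral \<open>(s - t) powr (H - 1/2) / (H - 1/2)\<close> over \<open>{t<..s}\<close>. Finiteness of the
  iterated integral makes the inner integral in the definition of the kernel converge for almost
  all \<open>u\<close> in the cube, and the lower bound comes from \<open>s\<close> in the right half of the interval.
\<close>

lemma hermite_kernel_box_integral:
  assumes "1 / 2 < H" "H < 1" "t \<ge> 0" "\<delta> > 0"
    and meas [measurable]: "hermite_kernel N H (t + \<delta>) \<in> borel_measurable (lebesgue_power N)"
  defines "C \<equiv> (\<lambda>u. \<Prod>p<N. indicator {t<..t + \<delta>} (u p) :: real)"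
  shows "integrable (lebesgue_power N) (\<lambda>u. hermite_kernel N H (t + \<delta>) u * C u)"
    and "(\<delta> / 2) powr (real N * (H - 1/2) + 1) \<le> (\<integral>u. hermite_kernel N H (t + \<delta>) u * C u \<partial>lebesgue_power N)"
proof -
  define a where "a = H - 3/2"
  have a: "a > -1" "a + 1 = H - 1/2" using assms by (auto simp: a_def)
  define g where "g u s = indicator {0..t + \<delta>} s * (\<Prod>p<N. pos_powr (s - u p) a)" for u :: "nat \<Rightarrow> real" and s :: real
  have g0: "g u s \<ge> 0" for u s
    unfolding g_def by (intro mult_nonneg_nonneg prod_nonneg) (auto simp: pos_powr_nonneg)
  have C0: "C u \<ge> 0" for u unfolding C_def by (intro prod_nonneg) auto
  have [measurable]: "C \<in> borel_measurable (lebesgue_power N)"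
    unfolding C_def by measurable
  have kernel: "hermite_kernel N H (t + \<delta>) u = (\<integral>s. g u s \<partial>lborel)" for u
    by (simp add: hermite_kernel_def set_lebesgue_integral_def g_def a_def)
  interpret product_sigma_finite "\<lambda>p::nat. lborel :: real measure"
    by (rule product_sigma_finite_lborel)
  interpret sf: sigma_finite_measure "lebesgue_power N"
    by (rule sigma_finite) simp
  interpret pair: pair_sigma_finite "lebesgue_power N" "lborel :: real measure" ..
  define \<phi> where "\<phi> s = (\<integral>\<^sup>+x. ennreal (pos_powr (s - x) a * indicator {t<..t + \<delta>} x) \<partial>lborel)" for s
  have gm [measurable]: "(\<lambda>(u, s). ennreal (g u s * C u)) \<in> borel_measurable (lebesgue_power N \<Otimes>\<^sub>M lborel)"
    unfolding g_def C_def by measurable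
  have gm' [measurable]: "g u \<in> borel_measurable borel" for u
    unfolding g_def by measurable
  have "(\<integral>\<^sup>+u. (\<integral>\<^sup>+s. ennreal (g u s * C u) \<partial>lborel) \<partial>lebesgue_power N)
      = (\<integral>\<^sup>+s. (\<integral>\<^sup>+u. ennreal (g u s * C u) \<partial>lebesgue_power N) \<partial>lborel)"
    by (rule pair.Fubini'[symmetric]) (rule gm)
  also have "\<dots> = (\<integral>\<^sup>+s. indicator {0..t + \<delta>} s * \<phi> s ^ N \<partial>lborel)"
  proof (intro nn_integral_cong)
    fix s :: real
    have "(\<integral>\<^sup>+u. ennreal (g u s * C u) \<partial>lebesgue_power N)
        = (\<integral>\<^sup>+u. indicator {0..t + \<delta>} s * (\<Prod>p<N. ennreal (pos_powr (s - u p) a * indicator {t<..t + \<delta>} (u p))) \<partial>lebesgue_power N)"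
    proof (intro nn_integral_cong)
      fix u
      have "g u s * C u = indicator {0..t + \<delta>} s * (\<Prod>p<N. pos_powr (s - u p) a * indicator {t<..t + \<delta>} (u p))"
        by (simp add: g_def C_def prod.distrib)
      moreover have "ennreal (\<Prod>p<N. pos_powr (s - u p) a * indicator {t<..t + \<delta>} (u p))
          = (\<Prod>p<N. ennreal (pos_powr (s - u p) a * indicator {t<..t + \<delta>} (u p)))"
        by (rule prod_ennreal[symmetric]) (simp add: pos_powr_nonneg)
      ultimately show "ennreal (g u s * C u)
          = indicator {0..t + \<delta>} s * (\<Prod>p<N. ennreal (pos_powr (s - u p) a * indicator {t<..t + \<delta>} (u p)))"
        by (simp only: ennreal_mult' ennreal_indicator indicator_pos_le)
    qed
    also have "\<dots> = indicator {0..t + \<delta>} s * (\<integral>\<^sup>+u. (\<Prod>p<N. ennreal (pos_powr (s - u p) a * indicator {t<..t + \<delta>} (u p))) \<partial>lebesgue_power N)"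
      by (rule nn_integral_cmult) measurable
    also have "(\<integral>\<^sup>+u. (\<Prod>p<N. ennreal (pos_powr (s - u p) a * indicator {t<..t + \<delta>} (u p))) \<partial>lebesgue_power N)
        = (\<Prod>p<N. \<phi> s)"
      unfolding \<phi>_def by (subst product_nn_integral_prod) auto
    finally show "(\<integral>\<^sup>+u. ennreal (g u s * C u) \<partial>lebesgue_power N) = indicator {0..t + \<delta>} s * \<phi> s ^ N"
      by simp
  qed
  finally have total: "(\<integral>\<^sup>+u. (\<integral>\<^sup>+s. ennreal (g u s * C u) \<partial>lborel) \<partial>lebesgue_power N)
      = (\<integral>\<^sup>+s. indicator {0..t + \<delta>} s * \<phi> s ^ N \<partial>lborel)" .
  have \<phi>: "\<phi> s = ennreal ((s - t) powr (H - 1/2) / (H - 1/2))" if "t \<le> s" "s \<le> t + \<delta>" for s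
    unfolding \<phi>_def using nn_integral_pos_powr[OF a(1) that] a(2) by simp
  have \<phi>0: "\<phi> s = 0" if "s \<le> t" for s
    unfolding \<phi>_def using that by (rule nn_integral_pos_powr_before)
  have up: "(\<integral>\<^sup>+s. indicator {0..t + \<delta>} s * \<phi> s ^ N \<partial>lborel) < \<infinity>"
  proof -
    define A where "A = \<delta> powr (H - 1/2) / (H - 1/2)"
    have "\<phi> s \<le> ennreal A" if "s \<le> t + \<delta>" for s
    proof (cases "t \<le> s")
      case True
      then have "(s - t) powr (H - 1/2) / (H - 1/2) \<le> A"
        unfolding A_def using that assms by (intro divide_right_mono powr_mono2) auto
      then show ?thesis using \<phi>[OF True that] by (simp add: ennreal_leI)
    qed (simp add: \<phi>0)
    then have "(\<integral>\<^sup>+s. indicator {0..t + \<delta>} s * \<phi> s ^ N \<partial>lborel)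
        \<le> (\<integral>\<^sup>+s. ennreal A ^ N * indicator {0..t + \<delta>} s \<partial>lborel)"
      by (intro nn_integral_mono) (auto simp: indicator_def intro!: power_mono)
    also have "\<dots> = ennreal A ^ N * ennreal (t + \<delta>)"
      using assms by (subst nn_integral_cmult_indicator) auto
    also have "\<dots> = ennreal (A ^ N * (t + \<delta>))"
      using assms by (simp add: A_def ennreal_power ennreal_mult)
    also have "\<dots> < \<infinity>" by simp
    finally show ?thesis .
  qed
  have low: "ennreal ((\<delta> / 2) powr (real N * (H - 1/2) + 1)) \<le> (\<integral>\<^sup>+s. indicator {0..t + \<delta>} s * \<phi> s ^ N \<partial>lborel)"
  proof -
    define A where "A = (\<delta> / 2) powr (H - 1/2)"
    have "ennreal A \<le> \<phi> s" if "t + \<delta> / 2 \<le> s" "s \<le> t + \<delta>" for s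
    proof -
      have "A \<le> (s - t) powr (H - 1/2)"
        unfolding A_def using that assms by (intro powr_mono2) auto
      also have "\<dots> \<le> (s - t) powr (H - 1/2) / (H - 1/2)"
        using assms by (simp add: pos_le_divide_eq mult_left_le)
      finally show ?thesis using \<phi>[of s] that assms by (simp add: ennreal_leI)
    qed
    then have "(\<integral>\<^sup>+s. ennreal A ^ N * indicator {t + \<delta> / 2..t + \<delta>} s \<partial>lborel)
        \<le> (\<integral>\<^sup>+s. indicator {0..t + \<delta>} s * \<phi> s ^ N \<partial>lborel)"
      using assms by (intro nn_integral_mono) (auto simp: indicator_def intro!: power_mono)
    moreover have "(\<integral>\<^sup>+s. ennreal A ^ N * indicator {t + \<delta> / 2..t + \<delta>} s \<partial>lborel) = ennreal A ^ N * ennreal (\<delta> / 2)"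
      using assms by (subst nn_integral_cmult_indicator) (auto simp: field_simps)
    moreover have "ennreal A ^ N * ennreal (\<delta> / 2) = ennreal ((\<delta> / 2) powr (real N * (H - 1/2) + 1))"
    proof -
      have "A ^ N = (\<delta> / 2) powr (real N * (H - 1/2))"
        using assms by (simp add: A_def powr_powr mult.commute flip: powr_realpow)
      then have "A ^ N * (\<delta> / 2) = (\<delta> / 2) powr (real N * (H - 1/2) + 1)"
        using assms by (simp add: powr_add)
      moreover have "A \<ge> 0" by (simp add: A_def)
      ultimately show ?thesis
        using assms by (simp add: ennreal_power flip: ennreal_mult)
    qed
    ultimately show ?thesis by simp
  qed
  have "AE u in lebesgue_power N. (\<integral>\<^sup>+s. ennreal (g u s * C u) \<partial>lborel) \<noteq> \<infinity>"
    using up unfolding total[symmetric] by (intro nn_integral_PInf_AE) (auto simp: less_top[symmetric])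
  then have "AE u in lebesgue_power N. ennreal (hermite_kernel N H (t + \<delta>) u * C u) = (\<integral>\<^sup>+s. ennreal (g u s * C u) \<partial>lborel)"
  proof eventually_elim
    case (elim u)
    have "integrable lborel (\<lambda>s. g u s * C u)"
      using elim g0 C0 by (intro integrableI_nonneg) (auto simp: less_top[symmetric])
    then have "(\<integral>\<^sup>+s. ennreal (g u s * C u) \<partial>lborel) = ennreal (\<integral>s. g u s * C u \<partial>lborel)"
      using g0 C0 by (intro nn_integral_eq_integral) auto
    then show ?case by (simp add: kernel)
  qed
  then have eq: "(\<integral>\<^sup>+u. ennreal (hermite_kernel N H (t + \<delta>) u * C u) \<partial>lebesgue_power N)
      = (\<integral>\<^sup>+s. indicator {0..t + \<delta>} s * \<phi> s ^ N \<partial>lborel)"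
    unfolding total[symmetric] by (rule nn_integral_cong_AE)
  have nonneg: "0 \<le> hermite_kernel N H (t + \<delta>) u * C u" for u
    unfolding kernel using g0 C0 by (intro mult_nonneg_nonneg integral_nonneg) auto
  show int: "integrable (lebesgue_power N) (\<lambda>u. hermite_kernel N H (t + \<delta>) u * C u)"
    using nonneg up eq by (intro integrableI_nonneg) auto
  have "ennreal ((\<delta> / 2) powr (real N * (H - 1/2) + 1))
      \<le> ennreal (\<integral>u. hermite_kernel N H (t + \<delta>) u * C u \<partial>lebesgue_power N)"
    using low nn_integral_eq_integral[OF int] nonneg unfolding eq by simp
  then show "(\<delta> / 2) powr (real N * (H - 1/2) + 1) \<le> (\<integral>u. hermite_kernel N H (t + \<delta>) u * C u \<partial>lebesgue_power N)"
    using nonneg by (subst (asm) ennreal_le_iff) (auto intro: integral_nonneg)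
qed

text \<open>
  On the cube over one of the pieces, only the kernel at the right end point of the piece contributes
  to the increment. With \<open>\<beta>\<close> the lower bound for its integral over the cube,
  \<open>\<beta> / \<delta> powr (N / 2)\<close> is of order \<open>\<delta> powr (N * (H - 1) + 1)\<close>, the scale on which the Hermite process
  varies.
\<close>

lemma (in brownian_motion) hermite_small_increments:
  assumes X: "hermite_process M B N H X" and "N \<ge> 1" "1 / 2 < H" "H < 1" "t \<ge> 0" "\<delta> > 0"
  shows "emeasure M {\<omega> \<in> space M. \<forall>i<L.
      \<bar>X (t + real (Suc i) * \<delta>) \<omega> - X (t + real i * \<delta>) \<omega>\<bar>
        \<le> 2 powr - (real N * (H - 1/2) + 2) / 4 * \<delta> powr (real N * (H - 1) + 1)}
    \<le> ennreal ((1 - 1 / (2 * 9 ^ N)) ^ L)"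
proof -
  define T where "T i = t + real i * \<delta>" for i
  define \<beta> where "\<beta> = (\<delta> / 2) powr (real N * (H - 1/2) + 1)"
  define \<sigma> where "\<sigma> = 2 powr - (real N * (H - 1/2) + 2) * \<delta> powr (real N * (H - 1) + 1)"
  have T: "T i \<ge> 0" "T (Suc i) = T i + \<delta>" for i
    using assms by (auto simp: T_def algebra_simps)
  have Y: "has_multiple_wiener_integral M B N (hermite_kernel N H (T i)) (X (T i))" for i
    using X T(1) by (auto simp: hermite_process_def)
  have meas: "hermite_kernel N H (T i) \<in> borel_measurable (lebesgue_power N)" for i
    using Y[of i] by (auto simp: has_multiple_wiener_integral_def)
  have \<sigma>: "\<sigma> * \<delta> powr (real N / 2) = \<beta> / 2"
  proof -
    define e where "e = real N * (H - 1/2) + 1"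
    have "2 powr - (e + 1) = 2 powr - e * (2::real) powr (-1)"
      unfolding powr_add[symmetric] by (rule arg_cong[where f = "\<lambda>z. 2 powr z"]) simp
    then have two: "2 powr - (e + 1) = 2 powr - e / (2::real)"
      by (simp add: powr_minus)
    have "\<delta> powr (real N * (H - 1) + 1) * \<delta> powr (real N / 2) = \<delta> powr e"
      unfolding powr_add[symmetric] e_def by (simp add: algebra_simps)
    moreover have "\<beta> = \<delta> powr e * 2 powr - e"
      unfolding \<beta>_def e_def[symmetric] using \<open>\<delta> > 0\<close> by (simp add: powr_divide powr_minus_divide)
    moreover have "\<sigma> = 2 powr - e / 2 * \<delta> powr (real N * (H - 1) + 1)"
      unfolding \<sigma>_def two[symmetric] by (simp add: e_def add.assoc)
    ultimately show ?thesis
      by (simp only: mult_ac times_divide_eq_left times_divide_eq_right)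
  qed
  have pow: "(\<delta> powr (real N / 2))\<^sup>2 = \<delta> ^ N"
    using \<open>\<delta> > 0\<close> by (simp add: power2_eq_square powr_realpow flip: powr_add)
  have \<sigma>2: "\<sigma>\<^sup>2 * \<delta> ^ N \<le> (\<beta> / 2)\<^sup>2"
    by (simp only: \<sigma>[symmetric] power_mult_distrib pow order_refl)
  have "emeasure M {\<omega> \<in> space M. \<forall>i<L. \<bar>X (T (Suc i)) \<omega> - X (T i) \<omega>\<bar> \<le> \<sigma> / 4}
      \<le> ennreal ((1 - 1 / (2 * 9 ^ N)) ^ L)"
  proof (rule small_increments_probability[where f = "\<lambda>i. hermite_kernel N H (T i)" and t = T and Y = "\<lambda>i. X (T i)" and \<beta> = \<beta> and \<delta> = \<delta>])
    fix i
    show "integrable (lebesgue_power N) (\<lambda>u. hermite_kernel N H (T (Suc i)) u * (\<Prod>p<N. indicator {T i<..T (Suc i)} (u p)))"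
      and "\<beta> \<le> (\<integral>u. hermite_kernel N H (T (Suc i)) u * (\<Prod>p<N. indicator {T i<..T (Suc i)} (u p)) \<partial>lebesgue_power N)"
      unfolding T(2) \<beta>_def using hermite_kernel_box_integral[of H "T i" \<delta> N] assms T meas[of "Suc i"] by auto
  qed (use assms Y T \<sigma>2 in \<open>auto simp: \<sigma>_def \<beta>_def intro: hermite_kernel_eq_0\<close>)
  then show ?thesis
    by (simp add: T_def \<sigma>_def)
qed

section \<open>Roughness of the paths\<close>

text \<open>
  Each of the first \<open>4 ^ m\<close> dyadic intervals of length \<open>2 ^ -m\<close> is cut into \<open>K * m\<close> equal pieces, and
  at least one of them must carry a large increment. The dyadic intervals cover \<open>{0..2 ^ m}\<close>, hence
  every fixed time for large \<open>m\<close>. With \<open>K * m\<close> pieces and \<open>K\<close> large, the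
  failure probability of one interval decays faster than the number of intervals grows.
\<close>

definition rough_at_level :: "(real \<Rightarrow> real) \<Rightarrow> real \<Rightarrow> real \<Rightarrow> nat \<Rightarrow> nat \<Rightarrow> bool" where
  "rough_at_level f \<kappa> h K m \<longleftrightarrow> (\<forall>k<4 ^ m. \<exists>i<K * m.
     \<kappa> * (1 / 2 ^ m / real (K * m)) powr h
       < \<bar>f (real k / 2 ^ m + real (Suc i) * (1 / 2 ^ m / real (K * m)))
          - f (real k / 2 ^ m + real i * (1 / 2 ^ m / real (K * m)))\<bar>)"

lemma Osc_ge:
  assumes "continuous_on {0..} f" "0 \<le> \<tau> - r" "s \<in> {\<tau> - r..\<tau> + r}" "t \<in> {\<tau> - r..\<tau> + r}"
  shows "\<bar>f s - f t\<bar> \<le> Osc f \<tau> r"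
proof -
  let ?I = "{\<tau> - r..\<tau> + r}"
  have "compact (f ` ?I)"
    using assms by (intro compact_continuous_image continuous_on_subset[OF assms(1)]) auto
  then obtain b where b: "\<And>x. x \<in> ?I \<Longrightarrow> \<bar>f x\<bar> \<le> b"
    using compact_imp_bounded by (force simp: bounded_iff)
  have "bdd_above ((\<lambda>(t', t''). \<bar>f t' - f t''\<bar>) ` (?I \<times> ?I))"
  proof (intro bdd_aboveI2[where M = "b + b"])
    fix z assume "z \<in> ?I \<times> ?I"
    then show "(case z of (t', t'') \<Rightarrow> \<bar>f t' - f t''\<bar>) \<le> b + b"
      using b[of "fst z"] b[of "snd z"] by (auto simp: case_prod_beta abs_le_iff)
  qed
  then show ?thesis
    unfolding Osc_def using assms cSUP_upper[of "(s, t)" "?I \<times> ?I" "\<lambda>(t', t''). \<bar>f t' - f t''\<bar>"] by auto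
qed

lemma Osc_le:
  assumes "r \<ge> 0" "\<And>s. s \<in> {\<tau> - r..\<tau> + r} \<Longrightarrow> \<bar>f s - f \<tau>\<bar> \<le> b"
  shows "Osc f \<tau> r \<le> 2 * b"
  unfolding Osc_def
proof (rule cSUP_least)
  show "{\<tau> - r..\<tau> + r} \<times> {\<tau> - r..\<tau> + r} \<noteq> {}" using assms(1) by auto
  fix z assume "z \<in> {\<tau> - r..\<tau> + r} \<times> {\<tau> - r..\<tau> + r}"
  then show "(case z of (t', t'') \<Rightarrow> \<bar>f t' - f t''\<bar>) \<le> 2 * b"
    using assms(2)[of "fst z"] assms(2)[of "snd z"] by (auto simp: case_prod_beta)
qed

text \<open>
  The interval \<open>{\<tau> - r..\<tau> + r}\<close> contains a dyadic interval whose length is at least \<open>r / 2\<close>. The level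
  of this interval is comparable to \<open>\<bar>log 2 r\<bar>\<close>, so its pieces have length at least of order
  \<open>r / \<bar>log 2 r\<bar>\<close>.
\<close>

lemma Osc_lower_bound_of_rough:
  assumes cont: "continuous_on {0..} f" and rough: "eventually (rough_at_level f \<kappa> h K) sequentially"
    and "\<tau> > 0" "\<kappa> > 0" "h > 0" "K > 0"
  shows "eventually (\<lambda>r. \<kappa> * (r / (4 * real K * \<bar>log 2 r\<bar>)) powr h \<le> Osc f \<tau> r) (at_right 0)"
proof -
  obtain m0 where m0: "\<And>m. m \<ge> m0 \<Longrightarrow> rough_at_level f \<kappa> h K m"
    using rough by (auto simp: eventually_sequentially)
  obtain m1 where m1: "\<tau> < 2 ^ m1" using real_arch_pow[of 2 \<tau>] by auto
  define r0 where "r0 = min (min (1/2) \<tau>) (min (1 / 2 ^ m0) (1 / 2 ^ m1))"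
  have "r0 > 0" using \<open>\<tau> > 0\<close> by (simp add: r0_def)
  have "\<kappa> * (r / (4 * real K * \<bar>log 2 r\<bar>)) powr h \<le> Osc f \<tau> r" if r: "0 < r" "r < r0" for r
  proof -
    have r_le: "r < 1/2" "r < \<tau>" "r < 1 / 2 ^ m0" "r < 1 / 2 ^ m1" using r by (auto simp: r0_def)
    \<comment> \<open>The least level with \<open>2 ^ -m \<le> r\<close>.\<close>
    define m where "m = nat \<lceil>- log 2 r\<rceil>"
    have log_gt: "- log 2 r > real l" if "r < 1 / 2 ^ l" for l
    proof -
      have "log 2 r < log 2 (1 / 2 ^ l)" using that r by simp
      then show ?thesis by (simp add: log_divide log_nat_power)
    qed
    have log1: "- log 2 r > 1" using log_gt[of 1] r_le(1) by simp
    have m_eq: "real m = of_int \<lceil>- log 2 r\<rceil>"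
      using log1 unfolding m_def by simp
    have m_ge: "- log 2 r \<le> real m"
      unfolding m_eq by (rule le_of_int_ceiling)
    have m_less: "real m < - log 2 r + 1"
      unfolding m_eq by linarith
    have "m \<ge> m0" "m \<ge> m1" "m > 0"
      using log_gt[OF r_le(3)] log_gt[OF r_le(4)] m_ge log1 by simp_all
    have pow_m: "2 powr - real m = 1 / (2::real) ^ m"
      by (simp only: powr_minus_divide) (simp add: powr_realpow)
    have pow_log: "2 powr log 2 r = r" "2 powr (log 2 r - 1) = r / 2"
      using r by (simp, simp only: powr_diff) simp
    have pow_le: "1 / 2 ^ m \<le> r"
    proof -
      have "2 powr - real m \<le> 2 powr log 2 r" using m_ge by (intro powr_mono) auto
      then show ?thesis by (simp only: pow_m pow_log)
    qed
    have pow_ge: "r / 2 \<le> 1 / 2 ^ m"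
    proof -
      have "2 powr (log 2 r - 1) \<le> 2 powr - real m" using m_less by (intro powr_mono) auto
      then show ?thesis by (simp only: pow_m pow_log)
    qed
    \<comment> \<open>The index of the dyadic interval that contains \<open>\<tau>\<close>.\<close>
    define k where "k = nat \<lfloor>\<tau> * 2 ^ m\<rfloor>"
    have k: "real k \<le> \<tau> * 2 ^ m" "\<tau> * 2 ^ m < real k + 1"
      using \<open>\<tau> > 0\<close> unfolding k_def by auto
    have "real k < 4 ^ m"
    proof -
      have "(2::real) ^ m1 \<le> 2 ^ m" using \<open>m \<ge> m1\<close> by (intro power_increasing) auto
      then have "\<tau> < 2 ^ m" using m1 by linarith
      then have "\<tau> * 2 ^ m < 2 ^ m * 2 ^ m" by simp
      also have "\<dots> = (4::real) ^ m" by (simp flip: power_mult_distrib)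
      finally show ?thesis using k(1) by (rule le_less_trans[rotated])
    qed
    then have "k < 4 ^ m" by (metis of_nat_less_iff of_nat_numeral of_nat_power)
    define \<delta> where "\<delta> = 1 / 2 ^ m / real (K * m)"
    define s where "s i = real k / 2 ^ m + real i * \<delta>" for i
    obtain i where i: "i < K * m" "\<kappa> * \<delta> powr h < \<bar>f (s (Suc i)) - f (s i)\<bar>"
      using m0[OF \<open>m \<ge> m0\<close>] \<open>k < 4 ^ m\<close> unfolding rough_at_level_def \<delta>_def s_def by blast
    have in_I: "s l \<in> {\<tau> - r..\<tau> + r}" if "l \<le> K * m" for l
    proof -
      have "real l * \<delta> \<le> real (K * m) * \<delta>"
        using that by (intro mult_right_mono) (auto simp: \<delta>_def simp del: of_nat_mult)
      also have "\<dots> = 1 / 2 ^ m" using \<open>K > 0\<close> \<open>m > 0\<close> by (simp add: \<delta>_def)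
      finally have "real l * \<delta> \<le> 1 / 2 ^ m" .
      moreover have "0 \<le> real l * \<delta>" by (simp add: \<delta>_def)
      moreover have "real k / 2 ^ m \<le> \<tau>" "\<tau> \<le> real k / 2 ^ m + 1 / 2 ^ m"
        using k by (simp_all add: field_simps)
      ultimately show ?thesis using pow_le by (auto simp: s_def)
    qed
    have L: "\<bar>log 2 r\<bar> = - log 2 r" using log1 by simp
    have "r / (4 * real K * \<bar>log 2 r\<bar>) \<le> \<delta>"
    proof -
      have "r / (4 * real K * \<bar>log 2 r\<bar>) = (r / 2) / (real K * (2 * \<bar>log 2 r\<bar>))" by simp
      also have "\<dots> \<le> (1 / 2 ^ m) / (real K * real m)"
      proof (rule frac_le[OF _ pow_ge])
        show "real K * real m \<le> real K * (2 * \<bar>log 2 r\<bar>)"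
          using m_less log1 L by (intro mult_left_mono) auto
      qed (use \<open>K > 0\<close> \<open>m > 0\<close> in auto)
      finally show ?thesis by (simp add: \<delta>_def)
    qed
    then have "(r / (4 * real K * \<bar>log 2 r\<bar>)) powr h \<le> \<delta> powr h"
      using r \<open>h > 0\<close> by (intro powr_mono2) auto
    then have "\<kappa> * (r / (4 * real K * \<bar>log 2 r\<bar>)) powr h \<le> \<kappa> * \<delta> powr h"
      using \<open>\<kappa> > 0\<close> by simp
    also have "\<dots> \<le> \<bar>f (s (Suc i)) - f (s i)\<bar>" using i by simp
    also have "\<dots> \<le> Osc f \<tau> r"
      using r_le i in_I by (intro Osc_ge[OF cont]) auto
    finally show ?thesis .
  qed
  then show ?thesis
    using \<open>r0 > 0\<close> by (auto simp: eventually_at_right_field)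
qed

text \<open>
  A pointwise bound of order \<open>\<mu>\<close> at \<open>\<tau>\<close> makes the oscillation \<open>O(r powr \<mu>)\<close>. For \<open>\<mu> > h\<close> this is of
  smaller order than \<open>(r / \<bar>log 2 r\<bar>) powr h\<close>, the logarithm notwithstanding.
\<close>

lemma no_Hoelder_bound_of_rough:
  assumes low: "eventually (\<lambda>r. \<kappa> * (r / (4 * real K * \<bar>log 2 r\<bar>)) powr h \<le> Osc f \<tau> r) (at_right 0)"
    and "\<kappa> > 0" "h > 0" "K > 0" "h < \<mu>"
    and up: "eventually (\<lambda>t. \<bar>f t - f \<tau>\<bar> \<le> b * \<bar>t - \<tau>\<bar> powr \<mu>) (at \<tau>)"
  shows False
proof -
  obtain d where d: "d > 0" "\<And>t. \<bar>t - \<tau>\<bar> < d \<Longrightarrow> t \<noteq> \<tau> \<Longrightarrow> \<bar>f t - f \<tau>\<bar> \<le> b * \<bar>t - \<tau>\<bar> powr \<mu>"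
    using up unfolding eventually_at by (auto simp: dist_real_def)
  have Osc_up: "Osc f \<tau> r \<le> 2 * (max b 0 * r powr \<mu>)" if r: "0 < r" "r < d" for r
  proof (rule Osc_le)
    fix s assume s: "s \<in> {\<tau> - r..\<tau> + r}"
    then have le: "\<bar>s - \<tau>\<bar> \<le> r" by (auto simp: abs_le_iff)
    show "\<bar>f s - f \<tau>\<bar> \<le> max b 0 * r powr \<mu>"
    proof (cases "s = \<tau>")
      case False
      then have "\<bar>f s - f \<tau>\<bar> \<le> b * \<bar>s - \<tau>\<bar> powr \<mu>" using d(2) le r by simp
      also have "\<dots> \<le> max b 0 * r powr \<mu>"
        using le assms by (intro mult_mono powr_mono2) auto
      finally show ?thesis .
    qed simp
  qed (use r in simp)
  have "eventually (\<lambda>r. r < d) (at_right (0::real))"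
    using d(1) by (intro eventually_at_rightI[of 0 d]) auto
  then have "eventually (\<lambda>r. \<kappa> * (r / (4 * real K * \<bar>log 2 r\<bar>)) powr h \<le> 2 * (max b 0 * r powr \<mu>)) (at_right 0)"
    using low eventually_at_right_less[of 0]
    by eventually_elim (use Osc_up in \<open>force intro: order.trans\<close>)
  moreover have "eventually (\<lambda>r. 2 * (max b 0 * r powr \<mu>) < \<kappa> * (r / (4 * real K * \<bar>log 2 r\<bar>)) powr h) (at_right 0)"
  proof -
    have "((\<lambda>r. r powr \<mu> / (r / (4 * real K * \<bar>log 2 r\<bar>)) powr h) \<longlongrightarrow> 0) (at_right 0)"
      using assms by real_asymp
    then have "((\<lambda>r. 2 * max b 0 * (r powr \<mu> / (r / (4 * real K * \<bar>log 2 r\<bar>)) powr h)) \<longlongrightarrow> 2 * max b 0 * 0) (at_right 0)"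
      by (intro tendsto_mult_left)
    then have "eventually (\<lambda>r. 2 * max b 0 * (r powr \<mu> / (r / (4 * real K * \<bar>log 2 r\<bar>)) powr h) < \<kappa>) (at_right 0)"
      using \<open>\<kappa> > 0\<close> by (intro order_tendstoD(2)[where y = "2 * max b 0 * 0"]) auto
    moreover have "eventually (\<lambda>r::real. r < 1) (at_right 0)"
      by (intro eventually_at_rightI[of 0 1]) auto
    ultimately show ?thesis
      using eventually_at_right_less[of 0]
    proof eventually_elim
      case (elim r)
      have "log 2 r \<noteq> 0" using elim by (simp add: log_def)
      then have "(r / (4 * real K * \<bar>log 2 r\<bar>)) powr h > 0"
        using elim \<open>K > 0\<close> by simp
      then show ?case using elim(1) by (simp add: field_simps)
    qed
  qed
  ultimately have "eventually (\<lambda>r::real. False) (at_right 0)"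
    by eventually_elim simp
  then show False by simp
qed

text \<open>
  The choice of \<open>K\<close> bounds the probability that all increments over the pieces of one dyadic
  interval are small by \<open>8 ^ -m\<close>. Summed over \<open>4 ^ m\<close> intervals this leaves \<open>2 ^ -m\<close>, and the
  Borel--Cantelli lemma applies.
\<close>

lemma (in brownian_motion) AE_eventually_rough:
  assumes X: "hermite_process M B N H X" and "N \<ge> 1" "1 / 2 < H" "H < 1"
    and K: "(1 - 1 / (2 * 9 ^ N)) ^ K \<le> (1 / 8 :: real)" "K > 0"
  defines "\<kappa> \<equiv> 2 powr - (real N * (H - 1/2) + 2) / 4" and "h \<equiv> real N * (H - 1) + 1"
  obtains \<Omega>' where "\<Omega>' \<in> sets M" "measure M \<Omega>' = 1"
    "\<And>\<omega>. \<omega> \<in> \<Omega>' \<Longrightarrow> eventually (rough_at_level (\<lambda>t. X t \<omega>) \<kappa> h K) sequentially"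
proof -
  define q where "q = (1 - 1 / (2 * 9 ^ N) :: real)"
  have [measurable]: "X t \<in> borel_measurable M" if "t \<ge> 0" for t
    using X that by (auto simp: hermite_process_def has_multiple_wiener_integral_def)
  define \<delta> where "\<delta> m = 1 / 2 ^ m / real (K * m)" for m
  define F where "F m k = {\<omega> \<in> space M. \<forall>i<K * m.
    \<bar>X (real k / 2 ^ m + real (Suc i) * \<delta> m) \<omega> - X (real k / 2 ^ m + real i * \<delta> m) \<omega>\<bar> \<le> \<kappa> * \<delta> m powr h}" for m k
  \<comment> \<open>Indexed from level 1, since at level 0 there are no pieces.\<close>
  define A where "A j = (\<Union>k<4 ^ Suc j. F (Suc j) k)" for j
  have F_meas [measurable]: "F m k \<in> sets M" for m k
  proof -
    have "\<delta> m \<ge> 0" by (simp add: \<delta>_def)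
    then have [measurable]: "X (real k / 2 ^ m + real i * \<delta> m) \<in> borel_measurable M" for i
      by simp
    show ?thesis unfolding F_def by measurable
  qed
  have A_meas [measurable]: "A j \<in> sets M" for j unfolding A_def by measurable
  have F_le: "measure M (F m k) \<le> (1 / 8) ^ m" if "m > 0" for m k
  proof -
    have F_q: "emeasure M (F m k) \<le> ennreal (q ^ (K * m))"
      unfolding F_def \<kappa>_def h_def q_def using assms that
      by (intro hermite_small_increments) (auto simp: \<delta>_def)
    have q_le: "q ^ (K * m) \<le> (1 / 8) ^ m"
    proof -
      have "(1::real) \<le> 9 ^ N" by simp
      then have "(1::real) \<le> 2 * 9 ^ N" by linarith
      then have "q \<ge> 0" unfolding q_def by (simp add: field_simps)
      then show ?thesis
        unfolding power_mult using K(1) by (intro power_mono) (auto simp: q_def)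
    qed
    have "ennreal (measure M (F m k)) \<le> ennreal ((1 / 8) ^ m)"
      using order.trans[OF F_q ennreal_leI[OF q_le]] by (simp only: emeasure_eq_measure)
    then show ?thesis by (subst (asm) ennreal_le_iff) auto
  qed
  have A_le: "measure M (A j) \<le> (1 / 2) ^ Suc j" for j
  proof -
    have "measure M (A j) \<le> (\<Sum>k<4 ^ Suc j. measure M (F (Suc j) k))"
      unfolding A_def by (intro finite_measure_subadditive_finite) auto
    also have "\<dots> \<le> (\<Sum>k<(4 ^ Suc j :: nat). (1 / 8) ^ Suc j)"
      by (intro sum_mono F_le) simp
    also have "\<dots> = 4 ^ Suc j * (1 / 8) ^ Suc j"
      by simp
    also have "\<dots> = (1 / 2 :: real) ^ Suc j"
      unfolding power_mult_distrib[symmetric] by simp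
    finally show ?thesis .
  qed
  have "summable (\<lambda>j. measure M (A j))"
  proof (rule summable_comparison_test')
    show "summable (\<lambda>j. (1 / 2 :: real) ^ Suc j)"
      by (subst summable_Suc_iff) (rule summable_geometric, simp)
    show "norm (measure M (A j)) \<le> (1 / 2) ^ Suc j" if "j \<ge> 0" for j using A_le[of j] by simp
  qed
  then have AE: "AE \<omega> in M. eventually (\<lambda>j. \<omega> \<in> space M - A j) sequentially"
    by (intro borel_cantelli_AE1) (auto simp: emeasure_eq_measure)
  define \<Omega>' where "\<Omega>' = {\<omega> \<in> space M. eventually (\<lambda>j. \<omega> \<in> space M - A j) sequentially}"
  show thesis
  proof
    show sets: "\<Omega>' \<in> sets M"
      unfolding \<Omega>'_def eventually_sequentially by measurable
    have "AE \<omega> in M. \<omega> \<in> \<Omega>'"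
      using AE AE_space by eventually_elim (simp add: \<Omega>'_def)
    then show "measure M \<Omega>' = 1"
      using prob_eq_1[OF sets] by simp
    fix \<omega> assume "\<omega> \<in> \<Omega>'"
    then have \<omega>: "\<omega> \<in> space M" and "eventually (\<lambda>j. \<omega> \<in> space M - A j) sequentially"
      by (auto simp: \<Omega>'_def)
    from this(2) have "eventually (\<lambda>j. rough_at_level (\<lambda>t. X t \<omega>) \<kappa> h K (Suc j)) sequentially"
    proof eventually_elim
      case (elim j)
      then have "\<omega> \<notin> F (Suc j) k" if "k < 4 ^ Suc j" for k
        using that by (auto simp: A_def)
      then show ?case
        using \<omega> unfolding rough_at_level_def F_def \<delta>_def by (force simp: not_le)
    qed
    then show "eventually (rough_at_level (\<lambda>t. X t \<omega>) \<kappa> h K) sequentially"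
      by (subst (asm) eventually_sequentially_Suc)
  qed
qed

theorem corollary1p3:
  fixes N :: nat and H :: real
  assumes "N \<ge> 1" and "1 - 1 / (2 * real N) < H" and "H < 1"
  shows "\<exists>c::real. c > 0 \<and>
    (\<forall>(M :: 'w measure) B X. brownian_motion M B \<longrightarrow> hermite_process M B N H X \<longrightarrow>
      (\<exists>\<Omega>'\<in>sets M. measure M \<Omega>' = 1 \<and>
        (\<forall>S. admissible_rate N H S \<longrightarrow> (\<forall>\<omega>\<in>\<Omega>'. \<forall>\<tau>>0.
           Liminf (at_right 0) (\<lambda>r. ereal
             ((inverse r * \<bar>log 2 r\<bar> * S \<bar>log 2 r\<bar>) powr (real N * (H - 1) + 1)
                * Osc (\<lambda>t. X t \<omega>) \<tau> r)) \<ge> ereal c)) \<and>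
        (\<forall>\<mu>. real N * (H - 1) + 1 < \<mu> \<and> \<mu> < 1 \<longrightarrow> (\<forall>\<omega>\<in>\<Omega>'. \<forall>\<tau>>0.
           Limsup (at \<tau>) (\<lambda>t. ereal (\<bar>X t \<omega> - X \<tau> \<omega>\<bar> / \<bar>t - \<tau>\<bar> powr \<mu>)) = \<infinity>)) \<and>
        (\<forall>\<omega>\<in>\<Omega>'. \<forall>\<tau>>0. \<not> (\<lambda>t. X t \<omega>) differentiable (at \<tau>))))"
proof -
  define h where "h = real N * (H - 1) + 1"
  define \<kappa> where "\<kappa> = 2 powr - (real N * (H - 1/2) + 2) / 4"
  have "\<kappa> > 0" by (simp add: \<kappa>_def)
  have "1 / (2 * real N) \<le> 1 / 2" using \<open>N \<ge> 1\<close> by (simp add: field_simps)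
  then have H: "1 / 2 < H" using assms by linarith
  have h: "h > 0" "h < 1"
  proof -
    have "real N * (1 - H) < 1 / 2"
      using assms by (simp add: field_simps)
    then show "h > 0" by (simp add: h_def algebra_simps)
    show "h < 1" using assms by (simp add: h_def mult_pos_neg)
  qed
  have q: "0 \<le> 1 - 1 / (2 * 9 ^ N :: real)" "1 - 1 / (2 * 9 ^ N :: real) < 1"
  proof -
    have "(1::real) \<le> 9 ^ N" by simp
    then have "(1::real) \<le> 2 * 9 ^ N" by linarith
    then show "0 \<le> 1 - 1 / (2 * 9 ^ N :: real)" by (simp add: field_simps)
  qed simp
  then obtain K' where "(1 - 1 / (2 * 9 ^ N :: real)) ^ K' < 1 / 8"
    using real_arch_pow_inv[of "1 / 8" "1 - 1 / (2 * 9 ^ N :: real)"] by auto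
  moreover define K where "K = Suc K'"
  ultimately have K: "(1 - 1 / (2 * 9 ^ N)) ^ K \<le> (1 / 8 :: real)" "K > 0"
    using q mult_left_le_one_le[of "(1 - 1 / (2 * 9 ^ N :: real)) ^ K'" "1 - 1 / (2 * 9 ^ N :: real)"] by auto
  \<comment> \<open>The value at \<open>S = 2\<close> of the lower bound \<open>\<kappa> * (S / (4 * real K)) powr h\<close> for the left side of (a).\<close>
  define c where "c = \<kappa> * (1 / (2 * real K)) powr h"
  have "c > 0" using \<open>\<kappa> > 0\<close> K by (simp add: c_def)
  show ?thesis
  proof (intro exI[of _ c] conjI allI impI \<open>c > 0\<close>)
    fix M :: "'w measure" and B X
    assume BM: "brownian_motion M B" and X: "hermite_process M B N H X"
    interpret brownian_motion M B by fact
    obtain \<Omega>' where \<Omega>': "\<Omega>' \<in> sets M" "measure M \<Omega>' = 1"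
      and rough: "\<And>\<omega>. \<omega> \<in> \<Omega>' \<Longrightarrow> eventually (rough_at_level (\<lambda>t. X t \<omega>) \<kappa> h K) sequentially"
      using AE_eventually_rough[OF X \<open>N \<ge> 1\<close> H \<open>H < 1\<close> K] unfolding \<kappa>_def h_def by blast
    have low: "eventually (\<lambda>r. \<kappa> * (r / (4 * real K * \<bar>log 2 r\<bar>)) powr h \<le> Osc (\<lambda>t. X t \<omega>) \<tau> r) (at_right 0)"
      if "\<omega> \<in> \<Omega>'" "\<tau> > 0" for \<omega> \<tau>
    proof -
      have "\<omega> \<in> space M" using that(1) \<Omega>'(1) sets.sets_into_space by blast
      then have "continuous_on {0..} (\<lambda>t. X t \<omega>)" using X by (simp add: hermite_process_def)
      then show ?thesis
        using rough[OF that(1)] that(2) \<open>\<kappa> > 0\<close> h K by (intro Osc_lower_bound_of_rough)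
    qed
    have no_bound: False
      if "\<omega> \<in> \<Omega>'" "\<tau> > 0" "h < \<mu>" "eventually (\<lambda>t. \<bar>X t \<omega> - X \<tau> \<omega>\<bar> \<le> b * \<bar>t - \<tau>\<bar> powr \<mu>) (at \<tau>)" for \<omega> \<tau> \<mu> b
      using no_Hoelder_bound_of_rough[OF low[OF that(1,2)] \<open>\<kappa> > 0\<close> h(1) K(2) that(3,4)] .
    show "\<exists>\<Omega>'\<in>sets M. measure M \<Omega>' = 1 \<and>
        (\<forall>S. admissible_rate N H S \<longrightarrow> (\<forall>\<omega>\<in>\<Omega>'. \<forall>\<tau>>0.
           Liminf (at_right 0) (\<lambda>r. ereal
             ((inverse r * \<bar>log 2 r\<bar> * S \<bar>log 2 r\<bar>) powr (real N * (H - 1) + 1)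
                * Osc (\<lambda>t. X t \<omega>) \<tau> r)) \<ge> ereal c)) \<and>
        (\<forall>\<mu>. real N * (H - 1) + 1 < \<mu> \<and> \<mu> < 1 \<longrightarrow> (\<forall>\<omega>\<in>\<Omega>'. \<forall>\<tau>>0.
           Limsup (at \<tau>) (\<lambda>t. ereal (\<bar>X t \<omega> - X \<tau> \<omega>\<bar> / \<bar>t - \<tau>\<bar> powr \<mu>)) = \<infinity>)) \<and>
        (\<forall>\<omega>\<in>\<Omega>'. \<forall>\<tau>>0. \<not> (\<lambda>t. X t \<omega>) differentiable (at \<tau>))"
      unfolding h_def[symmetric]
    proof (intro bexI[of _ \<Omega>'] conjI allI impI ballI \<Omega>')
      fix S \<omega> and \<tau> :: real
      assume S: "admissible_rate N H S" and "\<omega> \<in> \<Omega>'" "\<tau> > 0"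
      have S2: "S z \<ge> 2" if "z \<ge> 0" for z
      proof -
        have "mono_on {0..} S" "2 \<le> S 0" using S by (simp_all add: admissible_rate_def)
        then show ?thesis using mono_onD[of "{0..}" S 0 z] that by simp
      qed
      have "eventually (\<lambda>r::real. r < 1) (at_right 0)"
        by (intro eventually_at_rightI[of 0 1]) auto
      with low[OF \<open>\<omega> \<in> \<Omega>'\<close> \<open>\<tau> > 0\<close>] eventually_at_right_less[of 0]
      have "eventually (\<lambda>r. ereal c \<le> ereal ((inverse r * \<bar>log 2 r\<bar> * S \<bar>log 2 r\<bar>) powr h * Osc (\<lambda>t. X t \<omega>) \<tau> r)) (at_right 0)"
      proof eventually_elim
        case (elim r)
        define w where "w = inverse r * \<bar>log 2 r\<bar> * S \<bar>log 2 r\<bar>"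
        have "log 2 r \<noteq> 0" using elim by (simp add: log_def)
        then have "w * (r / (4 * real K * \<bar>log 2 r\<bar>)) = S \<bar>log 2 r\<bar> / (4 * real K)"
          using elim by (simp add: w_def)
        moreover have "1 / (2 * real K) \<le> S \<bar>log 2 r\<bar> / (4 * real K)"
          using divide_right_mono[of 2 "S \<bar>log 2 r\<bar>" "4 * real K"] S2[of "\<bar>log 2 r\<bar>"] by simp
        ultimately have "1 / (2 * real K) \<le> w * (r / (4 * real K * \<bar>log 2 r\<bar>))"
          by simp
        moreover have "w \<ge> 0"
          unfolding w_def using elim S2[of "\<bar>log 2 r\<bar>"] by (intro mult_nonneg_nonneg) auto
        ultimately have "(1 / (2 * real K)) powr h \<le> w powr h * (r / (4 * real K * \<bar>log 2 r\<bar>)) powr h"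
          using elim h K(2) by (subst powr_mult[symmetric]) (auto intro!: powr_mono2)
        then have "c \<le> w powr h * (\<kappa> * (r / (4 * real K * \<bar>log 2 r\<bar>)) powr h)"
          using \<open>\<kappa> > 0\<close> mult_left_mono[of "(1 / (2 * real K)) powr h" _ \<kappa>] by (simp add: c_def mult_ac)
        also have "\<dots> \<le> w powr h * Osc (\<lambda>t. X t \<omega>) \<tau> r"
          using elim by (intro mult_left_mono) auto
        finally show ?case by (simp add: w_def)
      qed
      then show "ereal c \<le> Liminf (at_right 0) (\<lambda>r. ereal
             ((inverse r * \<bar>log 2 r\<bar> * S \<bar>log 2 r\<bar>) powr h * Osc (\<lambda>t. X t \<omega>) \<tau> r))"
        by (rule Liminf_bounded)
    next
      fix \<mu> \<omega> and \<tau> :: real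
      assume \<mu>: "h < \<mu> \<and> \<mu> < 1" and \<omega>: "\<omega> \<in> \<Omega>'" "\<tau> > 0"
      show "Limsup (at \<tau>) (\<lambda>t. ereal (\<bar>X t \<omega> - X \<tau> \<omega>\<bar> / \<bar>t - \<tau>\<bar> powr \<mu>)) = \<infinity>"
      proof (rule ccontr)
        assume "Limsup (at \<tau>) (\<lambda>t. ereal (\<bar>X t \<omega> - X \<tau> \<omega>\<bar> / \<bar>t - \<tau>\<bar> powr \<mu>)) \<noteq> \<infinity>"
        then obtain b where "Limsup (at \<tau>) (\<lambda>t. ereal (\<bar>X t \<omega> - X \<tau> \<omega>\<bar> / \<bar>t - \<tau>\<bar> powr \<mu>)) < ereal b"
          using less_PInf_Ex_of_nat by (metis ereal_dense2 ereal_infty_less(1))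
        then have "eventually (\<lambda>t. ereal (\<bar>X t \<omega> - X \<tau> \<omega>\<bar> / \<bar>t - \<tau>\<bar> powr \<mu>) < ereal b) (at \<tau>)"
          by (rule Limsup_lessD)
        then have "eventually (\<lambda>t. \<bar>X t \<omega> - X \<tau> \<omega>\<bar> \<le> b * \<bar>t - \<tau>\<bar> powr \<mu>) (at \<tau>)"
          using eventually_neq_at_within[of \<tau>]
          by eventually_elim (simp add: pos_divide_less_eq less_imp_le)
        then show False using no_bound \<omega> \<mu> by blast
      qed
    next
      fix \<omega> and \<tau> :: real
      assume \<omega>: "\<omega> \<in> \<Omega>'" "\<tau> > 0"
      show "\<not> (\<lambda>t. X t \<omega>) differentiable (at \<tau>)"
      proof
        assume "(\<lambda>t. X t \<omega>) differentiable (at \<tau>)"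
        then obtain D where "((\<lambda>t. X t \<omega>) has_real_derivative D) (at \<tau>)"
          by (auto simp: real_differentiable_def)
        then have "((\<lambda>t. (X t \<omega> - X \<tau> \<omega>) / (t - \<tau>)) \<longlongrightarrow> D) (at \<tau>)"
          by (simp add: has_field_derivative_iff)
        then have "((\<lambda>t. \<bar>(X t \<omega> - X \<tau> \<omega>) / (t - \<tau>)\<bar>) \<longlongrightarrow> \<bar>D\<bar>) (at \<tau>)"
          by (rule tendsto_rabs)
        then have "eventually (\<lambda>t. \<bar>(X t \<omega> - X \<tau> \<omega>) / (t - \<tau>)\<bar> < \<bar>D\<bar> + 1) (at \<tau>)"
          by (rule order_tendstoD) simp
        then have "eventually (\<lambda>t. \<bar>X t \<omega> - X \<tau> \<omega>\<bar> \<le> (\<bar>D\<bar> + 1) * \<bar>t - \<tau>\<bar> powr 1) (at \<tau>)"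
          using eventually_neq_at_within[of \<tau>]
          by eventually_elim (simp add: abs_divide pos_divide_less_eq less_imp_le)
        then show False using no_bound \<omega> h by blast
      qed
    qed
  qed
qed

end
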